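(* Let $n \geq 3$ and $k \geq 0$, and let $X$ be the set of A-multidissections of the regular $n$-gon $\mathbb{P}_n$ with $k$ edges. Let the cyclic group $C = \mathbb{Z}_n$ of order $n$ act on $X$ by rotation. Then the triple $(X, C, X(q))$ exhibits the cyclic sieving phenomenon, where $$X(q) = q^{-k}\, s_{(k,k)}(1,q,\dots,q^{n-1}).$$
   Context: Cyclic sieving phenomenon (CSP): let $X$ be a finite set, let $C = \langle c \rangle$ be a finite cyclic group acting on $X$ with distinguished generator $c$, and let $X(q) \in \mathbb{N}[q]$. Let $\zeta \in \mathbb{C}$ be a root of unity with the same multiplicative order as $c$. The triple $(X,C,X(q))$ exhibits the CSP if for all integers $d \geq 0$ the number of elements of $X$ fixed by $c^d$ equals $X(\zeta^d)$. A-multidissections: for $n \ge 3$, $\mathbb{P}_n$ is the regular $n$-gon with vertices labeled clockwise $1,\dots,n$, and $E_A = \binom{[n]}{2}$ is the set of all its edges, i.e. all segments joining two distinct vertices (both diagonals and boundary sides). Two edges cross if they are distinct and meet at a point interior to both; equivalently, the edges $\{a<b\}$ and $\{c<d\}$ cross iff $a<c<b<d$ or $c<a<d<b$. An A-multidissection of $\mathbb{P}_n$ is a function $f: E_A \to \mathbb{N} = \{0,1,2,\dots\}$ such that whenever $e,e'$ are crossing edges, $f(e)=0$ or $f(e')=0$. It has $k$ edges if $\sum_{e \in E_A} f(e) = k$. The distinguished generator of $\mathbb{Z}_n$ acts on A-multidissections by the rotation of $\mathbb{P}_n$ by one step ($i \mapsto i+1$ modulo $n$ on vertices). $s_\lambda(x_1,\dots,x_n)$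 denotes the Schur polynomial of the partition $\lambda$ in $n$ variables, i.e. the sum of $\prod_i x_i^{\#\{\text{entries of } T \text{ equal to } i\}}$ over semistandard tableaux $T$ of shape $\lambda$ with entries in $\{1,\dots,n\}$ (rows weakly increasing, columns strictly increasing). For $k=0$ it is $1$. *)

theory Defs
  imports
    "HOL-Algebra.Group_Action"
    "HOL-Algebra.Elementary_Groups"
    "HOL-Algebra.Multiplicative_Group"
    "HOL-Computational_Algebra.Polynomial"
begin

section \<open>Cyclic sieving\<close>

definition root_of_unity_of_order :: "nat \<Rightarrow> complex \<Rightarrow> bool" where
  "root_of_unity_of_order m \<zeta> \<longleftrightarrow>
     0 < m \<and> \<zeta> ^ m = 1 \<and> (\<forall>j. 0 < j \<and> j < m \<longrightarrow> \<zeta> ^ j \<noteq> 1)"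

text \<open>
  The polynomial has natural number coefficients, so it is mapped to a complex polynomial before
  evaluation. The evaluation condition is required for every root of unity whose order is that
  of the distinguished generator \<open>c\<close> in the group \<open>C\<close>.
\<close>

definition exhibits_CSP ::
  "'x set \<Rightarrow> ('g, 'm) monoid_scheme \<Rightarrow> 'g \<Rightarrow> ('g \<Rightarrow> 'x \<Rightarrow> 'x) \<Rightarrow> nat poly \<Rightarrow> bool" where
  "exhibits_CSP X C c \<phi> P \<longleftrightarrow>
     finite X \<and> finite (carrier C) \<and>
     c \<in> carrier C \<and> generate C {c} = carrier C \<and>
     group_action C X \<phi> \<and>
     (\<forall>\<zeta>. root_of_unity_of_order (group.ord C c) \<zeta> \<longrightarrow>
        (\<forall>d::nat. of_nat (card (invariants X \<phi> (c [^]\<^bsub>C\<^esub> d))) =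
                   poly (map_poly of_nat P) (\<zeta> ^ d)))"

section \<open>Multidissections\<close>

text \<open>
  The vertices of the \<open>n\<close>-gon are the integers from 1 to \<open>n\<close> in cyclic order; an edge is
  the set of its two endpoints.
\<close>

definition polygon_edges :: "nat \<Rightarrow> int set set" where
  "polygon_edges n = {e. e \<subseteq> {1..int n} \<and> card e = 2}"

definition crossing :: "int set \<Rightarrow> int set \<Rightarrow> bool" where
  "crossing e e' \<longleftrightarrow>
     (\<exists>a b c d. e = {a, b} \<and> e' = {c, d} \<and> a < b \<and> c < d \<and>
        (a < c \<and> c < b \<and> b < d \<or> c < a \<and> a < d \<and> d < b))"

definition A_multidissections :: "nat \<Rightarrow> nat \<Rightarrow> (int set \<Rightarrow> nat) set" where
  "A_multidissections n k =
     {f \<in> polygon_edges n \<rightarrow>\<^sub>E UNIV.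
        (\<forall>e \<in> polygon_edges n. \<forall>e' \<in> polygon_edges n.
            crossing e e' \<longrightarrow> f e = 0 \<or> f e' = 0) \<and>
        (\<Sum>e \<in> polygon_edges n. f e) = k}"

definition rotate_vertex :: "nat \<Rightarrow> int \<Rightarrow> int \<Rightarrow> int" where
  "rotate_vertex n j i = (i - 1 + j) mod int n + 1"

text \<open>
  Rotation by \<open>j\<close> steps moves the multiplicity of an edge to the rotated edge, so the
  rotated function takes at \<open>e\<close> the old value at \<open>e\<close> rotated back by \<open>j\<close> steps.
  The restriction to \<open>A_multidissections n k\<close> is what \<^const>\<open>group_action\<close> asks of
  functions on a carrier.
\<close>

definition rotation_action :: "nat \<Rightarrow> nat \<Rightarrow> int \<Rightarrow> (int set \<Rightarrow> nat) \<Rightarrow> (int set \<Rightarrow> nat)" where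
  "rotation_action n k j =
     (\<lambda>f \<in> A_multidissections n k. \<lambda>e \<in> polygon_edges n. f (rotate_vertex n (- j) ` e))"

section \<open>Schur polynomials\<close>

text \<open>
  A partition is the list of its parts; its cells are pairs (row, column), counted from 0.
\<close>

definition cells :: "nat list \<Rightarrow> (nat \<times> nat) set" where
  "cells sh = {(r, s). r < length sh \<and> s < sh ! r}"

definition semistandard_tableaux :: "nat list \<Rightarrow> nat \<Rightarrow> (nat \<times> nat \<Rightarrow> nat) set" where
  "semistandard_tableaux sh n =
     {T \<in> cells sh \<rightarrow>\<^sub>E {1..n}.
        (\<forall>r s s'. (r, s) \<in> cells sh \<and> (r, s') \<in> cells sh \<and> s < s' \<longrightarrow> T (r, s) \<le> T (r, s')) \<and>
        (\<forall>r r' s. (r, s) \<in> cells sh \<and> (r', s) \<in> cells sh \<and> r < r' \<longrightarrow> T (r, s) < T (r', s))}"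

text \<open>The Schur polynomial in \<open>n\<close> variables, evaluated at \<open>x 1, \<dots>, x n\<close>.\<close>

definition schur :: "nat list \<Rightarrow> nat \<Rightarrow> (nat \<Rightarrow> 'a::comm_semiring_1) \<Rightarrow> 'a" where
  "schur sh n x =
     (\<Sum>T \<in> semistandard_tableaux sh n. \<Prod>i = 1..n. x i ^ card {u \<in> cells sh. T u = i})"

end

theory Submission
  imports Defs "HOL-Computational_Algebra.Computational_Algebra" "HOL-Library.Multiset"
begin

text \<open>
  Both sides are computed. A noncrossing multiset of arcs, on a line or on a circle, is determined
  by the number of arcs that open and the number of arcs that close at each vertex: among all
  arrays with given row and column sums, one of least cost, for a suitable cost, is noncrossing, and two
  noncrossing arrays with the same sums agree. On the line the possible pairs of sums are the ballot
  pairs, that is, the contents of the two rows of a semistandard tableau of shape \<open>(k, k)\<close>;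
  this settles the identity rotation. If \<open>n = m N\<close> with \<open>m \<ge> 2\<close>, a dissection
  invariant under rotation by \<open>N\<close> uses only edges of cyclic length at most \<open>N\<close> and
  becomes a noncrossing array of arcs modulo \<open>N\<close>; there all pairs of sums with
  equal totals occur. For \<open>m = 2\<close> a diameter of odd multiplicity, of which there is at most
  one, contributes an arc that never closes.

  On the other side, \<open>s\<^bsub>(k,k)\<^esub> = h\<^sub>k h\<^sub>k - h\<^bsub>k+1\<^esub> h\<^bsub>k-1\<^esub>\<close>, and at
  \<open>1, q, \<dots>, q\<^bsup>n-1\<^esup>\<close> with \<open>q\<close> of order \<open>m\<close> the generating function of
  the \<open>h\<^sub>a\<close> is \<open>1 / (1 - X\<^bsup>m\<^esup>)\<^bsup>N\<^esup>\<close>, so \<open>h\<^sub>a\<close> vanishes unless \<open>m\<close>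
  divides \<open>a\<close> and then counts multisets of size \<open>a / m\<close> on \<open>N\<close> points.
\<close>

section \<open>Uncrossing: noncrossing representatives of given margins\<close>

section \<open>Noncrossing arrays with given margins\<close>

text \<open>Arcs modulo \<open>N\<close> describe an invariant dissection because an edge longer
  than \<open>N\<close> in both directions crosses its own rotation by \<open>N\<close>, while a
  shorter edge has a preferred direction, the short way round. Two cases escape this. For
  \<open>m = 1\<close> every edge is short both ways, so the identity is treated on a line, where
  edges run from the smaller to the larger vertex; the price is the ballot condition, which a circle
  does not impose. For \<open>m = 2\<close> a diameter is short both ways and its closed arc adds
  two to its multiplicity, so an odd multiplicity needs an arc of another kind.

  The same dichotomy appears in \<open>h_k h_k - h_(k+1) h_(k-1)\<close>: for
  \<open>m \<ge> 2\<close> the first product survives if \<open>m\<close> divides \<open>k\<close>,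
  the second only if \<open>m\<close> divides both \<open>k + 1\<close> and \<open>k - 1\<close>,
  that is, for \<open>m = 2\<close> and odd \<open>k\<close>. There \<open>k div 2 + 1\<close>
  openings and \<open>k div 2\<close> closings account for the two factors, and
  \<open>q^(-k)\<close>, equal to \<open>-1\<close>, repairs the sign.\<close>

lemma sum_restrict: "A \<subseteq> B \<Longrightarrow> sum (restrict F B) A = sum F A"
  by (rule sum.cong) auto

lemma sum_nested_eq:
  assumes "finite I" "finite J" "S \<subseteq> I \<times> J" "\<And>p. p \<notin> S \<Longrightarrow> g p = (0::nat)"
  shows "(\<Sum>i\<in>I. \<Sum>j\<in>J. g (i, j)) = sum g S"
proof -
  have "(\<Sum>i\<in>I. \<Sum>j\<in>J. g (i, j)) = sum g (I \<times> J)"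
    by (simp add: sum.cartesian_product)
  also have "\<dots> = sum g S"
    by (rule sum.mono_neutral_right) (use assms in auto)
  finally show ?thesis .
qed

text \<open>Given two words of length \<open>k\<close>, the number of positions carrying a given
  pair of letters is an array; the free predicate \<open>P\<close> fixes one letter, so one
  statement yields both row and column sums.\<close>

lemma sum_card_fibres:
  assumes "finite A" "\<And>s. s < k \<Longrightarrow> v s \<in> A"
  shows "(\<Sum>j\<in>A. card {s. s < k \<and> P s \<and> v s = j}) = card {s. s < (k::nat) \<and> P s}"
proof -
  have "(\<Sum>j\<in>A. card {s. s < k \<and> P s \<and> v s = j}) = card (\<Union>j\<in>A. {s. s < k \<and> P s \<and> v s = j})"
    by (rule card_UN_disjoint[symmetric]) (use assms in auto)
  also have "(\<Union>j\<in>A. {s. s < k \<and> P s \<and> v s = j}) = {s. s < k \<and> P s}"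
    using assms by auto
  finally show ?thesis .
qed

text \<open>The two main assumptions serve the two halves of the bijection: \<open>uncross\<close>
  makes an array of least total cost noncrossing (existence), \<open>cross_longer\<close> forbids
  compensation at a shortest discrepancy (uniqueness). Openings and closings have different types so
  that a column for arcs that never close can be added.\<close>

locale uncrossing =
  fixes I :: "'a set" and J :: "'b set" and S :: "('a \<times> 'b) set"
    and cross :: "'a \<times> 'b \<Rightarrow> 'a \<times> 'b \<Rightarrow> bool" and len cost :: "'a \<times> 'b \<Rightarrow> nat"
  assumes finite_I: "finite I" and finite_J: "finite J" and S_subset: "S \<subseteq> I \<times> J"
    and uncross: "\<And>i x k y. (i, x) \<in> S \<Longrightarrow> (k, y) \<in> S \<Longrightarrow> cross (i, x) (k, y) \<Longrightarrow>
      (i, y) \<in> S \<and> (k, x) \<in> S \<and> cost (i, y) + cost (k, x) < cost (i, x) + cost (k, y)"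
    and cross_longer: "\<And>i x k y. (i, x) \<in> S \<Longrightarrow> (i, y) \<in> S \<Longrightarrow> (k, x) \<in> S \<Longrightarrow> x \<noteq> y \<Longrightarrow> k \<noteq> i \<Longrightarrow>
      len (i, x) \<le> len (i, y) \<Longrightarrow> len (i, x) \<le> len (k, x) \<Longrightarrow> cross (k, x) (i, y)"
begin

definition arrays :: "('a \<times> 'b \<Rightarrow> nat) set" where
  "arrays = {g. \<forall>p. p \<notin> S \<longrightarrow> g p = 0}"

definition noncrossing :: "('a \<times> 'b \<Rightarrow> nat) set" where
  "noncrossing = {g \<in> arrays. \<forall>p q. cross p q \<longrightarrow> g p = 0 \<or> g q = 0}"

definition margins :: "('a \<times> 'b \<Rightarrow> nat) \<Rightarrow> ('a \<Rightarrow> nat) \<times> ('b \<Rightarrow> nat)" where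
  "margins g = (\<lambda>i\<in>I. \<Sum>x\<in>J. g (i, x), \<lambda>x\<in>J. \<Sum>i\<in>I. g (i, x))"

lemma margins_eq_iff:
  "margins g = margins g' \<longleftrightarrow>
     (\<forall>i\<in>I. (\<Sum>x\<in>J. g (i, x)) = (\<Sum>x\<in>J. g' (i, x))) \<and>
     (\<forall>x\<in>J. (\<Sum>i\<in>I. g (i, x)) = (\<Sum>i\<in>I. g' (i, x)))"
  unfolding margins_def by (auto simp: fun_eq_iff restrict_def)

lemma larger_elsewhere:
  fixes f f' :: "'c \<Rightarrow> nat"
  assumes "finite A" "sum f A = sum f' A" "a \<in> A" "f' a < f a"
  obtains b where "b \<in> A" "b \<noteq> a" "f b < f' b"
proof -
  have "\<exists>b\<in>A. f b < f' b"
  proof (rule ccontr)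
    assume "\<not> ?thesis"
    then have "\<forall>b\<in>A. f' b \<le> f b" by force
    then have "sum f' A < sum f A"
      by (intro sum_strict_mono_ex1) (use assms in auto)
    then show False using assms by simp
  qed
  then show ?thesis using that assms(4) by force
qed

text \<open>At a shortest discrepancy \<open>(i, x)\<close> in which \<open>g\<close> is larger, \<open>g'\<close>
  must compensate in row \<open>i\<close> and in column \<open>x\<close> by longer arcs, which cross.\<close>

lemma discrepancy_crosses:
  assumes g: "g \<in> arrays" and g': "g' \<in> noncrossing" and eq: "margins g = margins g'"
    and less: "g' (i, x) < g (i, x)"
    and minimal: "\<And>p. g p \<noteq> g' p \<Longrightarrow> len (i, x) \<le> len p"
  shows False
proof -
  have ix: "(i, x) \<in> S" using less g by (auto simp: arrays_def intro: ccontr)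
  then have i: "i \<in> I" and x: "x \<in> J" using S_subset by auto
  obtain y where y: "y \<in> J" "y \<noteq> x" "g (i, y) < g' (i, y)"
    using larger_elsewhere[of J "\<lambda>y. g (i, y)" "\<lambda>y. g' (i, y)" x] finite_J eq i x less
    unfolding margins_eq_iff by blast
  obtain k where k: "k \<in> I" "k \<noteq> i" "g (k, x) < g' (k, x)"
    using larger_elsewhere[of I "\<lambda>k. g (k, x)" "\<lambda>k. g' (k, x)" i] finite_I eq i x less
    unfolding margins_eq_iff by blast
  have S: "(i, y) \<in> S" "(k, x) \<in> S"
    using y(3) k(3) g' by (auto simp: arrays_def noncrossing_def intro: ccontr)
  have cr: "cross (k, x) (i, y)"
    by (rule cross_longer) (use ix S y k minimal in auto)
  have "\<forall>p q. cross p q \<longrightarrow> g' p = 0 \<or> g' q = 0"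
    using g' by (simp add: noncrossing_def del: split_paired_All)
  from this[rule_format, OF cr] show False using y(3) k(3) by auto
qed

lemma inj_on_margins: "inj_on margins noncrossing"
proof (rule inj_onI, rule ccontr)
  fix g g' assume g: "g \<in> noncrossing" "g' \<in> noncrossing" "margins g = margins g'" "g \<noteq> g'"
  then obtain p0 where "g p0 \<noteq> g' p0" by (meson ext)
  then obtain p where p: "g p \<noteq> g' p" "\<And>r. g r \<noteq> g' r \<Longrightarrow> len p \<le> len r"
    using ex_has_least_nat[of "\<lambda>p. g p \<noteq> g' p" p0 len] by blast
  obtain i x where [simp]: "p = (i, x)" by (cases p)
  show False
  proof (cases "g p < g' p")
    case True
    then show False
      using discrepancy_crosses[of g' g i x] g p by (auto simp: noncrossing_def)
  next
    case False
    then show False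
      using discrepancy_crosses[of g g' i x] g p by (auto simp: noncrossing_def)
  qed
qed

lemma uncross_step:
  assumes g: "g \<in> arrays" and cr: "cross p q" "g p \<noteq> 0" "g q \<noteq> 0"
  obtains g' where "g' \<in> arrays" "margins g' = margins g"
    "(\<Sum>p\<in>S. g' p * cost p) < (\<Sum>p\<in>S. g p * cost p)"
proof -
  obtain i x k y where pq: "p = (i, x)" "q = (k, y)" by (cases p, cases q)
  have S: "(i, x) \<in> S" "(k, y) \<in> S" using g cr pq unfolding arrays_def by fastforce+
  from uncross[OF S] cr pq have S': "(i, y) \<in> S" "(k, x) \<in> S"
    and c: "cost (i, y) + cost (k, x) < cost (i, x) + cost (k, y)" by auto
  \<comment> \<open>Equal rows or columns would make both sides of the cost inequality the same;
    hence the four cells are distinct and the updates below do not interfere.\<close>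
  have ne: "i \<noteq> k" "x \<noteq> y" using c by auto
  define D :: "'a \<times> 'b \<Rightarrow> 'a \<times> 'b \<Rightarrow> nat" where "D = (\<lambda>a u. if u = a then 1 else 0 :: nat)"
  define g' where "g' = g((i, x) := g (i, x) - 1, (k, y) := g (k, y) - 1,
    (i, y) := g (i, y) + 1, (k, x) := g (k, x) + 1)"
  \<comment> \<open>Balanced form that avoids truncated subtraction. Summed along rows, along
    columns, and over \<open>S\<close> with weight \<open>cost\<close>, it gives the three
    claims.\<close>
  have bal: "g' u + (D (i, x) u + D (k, y) u) = g u + (D (i, y) u + D (k, x) u)" for u
    using cr pq ne by (auto simp: g'_def D_def)
  have mem: "i \<in> I" "k \<in> I" "x \<in> J" "y \<in> J" using S S_subset by auto
  have "g' \<in> arrays" using g S S' by (auto simp: arrays_def g'_def)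
  moreover have "margins g' = margins g"
    unfolding margins_eq_iff
  proof (intro conjI ballI)
    fix a assume "a \<in> I"
    have "(\<Sum>z\<in>J. g' (a, z) + (D (i, x) (a, z) + D (k, y) (a, z))) =
          (\<Sum>z\<in>J. g (a, z) + (D (i, y) (a, z) + D (k, x) (a, z)))"
      using bal by simp
    moreover have "(\<Sum>z\<in>J. D (b, w) (a, z)) = (if a = b then 1 else 0)" if "w \<in> J" for b w
      using that finite_J by (auto simp: D_def)
    ultimately show "(\<Sum>z\<in>J. g' (a, z)) = (\<Sum>z\<in>J. g (a, z))"
      using mem by (simp add: sum.distrib)
  next
    fix z assume "z \<in> J"
    have "(\<Sum>a\<in>I. g' (a, z) + (D (i, x) (a, z) + D (k, y) (a, z))) =
          (\<Sum>a\<in>I. g (a, z) + (D (i, y) (a, z) + D (k, x) (a, z)))"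
      using bal by simp
    moreover have "(\<Sum>a\<in>I. D (b, w) (a, z)) = (if z = w then 1 else 0)" if "b \<in> I" for b w
      using that finite_I by (auto simp: D_def)
    ultimately show "(\<Sum>a\<in>I. g' (a, z)) = (\<Sum>a\<in>I. g (a, z))"
      using mem by (simp add: sum.distrib)
  qed
  moreover have "(\<Sum>p\<in>S. g' p * cost p) < (\<Sum>p\<in>S. g p * cost p)"
  proof -
    have fin: "finite S" using S_subset finite_I finite_J finite_subset by blast
    have "(\<Sum>u\<in>S. (g' u + (D (i, x) u + D (k, y) u)) * cost u) =
          (\<Sum>u\<in>S. (g u + (D (i, y) u + D (k, x) u)) * cost u)"
      using bal by simp
    moreover have "(\<Sum>u\<in>S. D b u * cost u) = cost b" if "b \<in> S" for b
      using that fin by (auto simp: D_def if_distrib[of "\<lambda>t. t * _"] cong: if_cong)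
    ultimately show ?thesis using S S' c by (simp add: sum.distrib distrib_right)
  qed
  ultimately show ?thesis using that by blast
qed

text \<open>Minimising the total cost over all arrays with the same margins replaces iterated
  uncrossing. Counting noncrossing arrays is thereby reduced to deciding which margins occur at
  all.\<close>

theorem bij_betw_margins: "bij_betw margins noncrossing (margins ` arrays)"
proof -
  have "margins g \<in> margins ` noncrossing" if g: "g \<in> arrays" for g
  proof -
    obtain g' where g': "g' \<in> arrays" "margins g' = margins g"
      and least: "\<And>h. h \<in> arrays \<Longrightarrow> margins h = margins g \<Longrightarrow>
        (\<Sum>p\<in>S. g' p * cost p) \<le> (\<Sum>p\<in>S. h p * cost p)"
      using ex_has_least_nat[of "\<lambda>h. h \<in> arrays \<and> margins h = margins g" g
          "\<lambda>h. \<Sum>p\<in>S. h p * cost p"] g by blast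
    have "g' \<in> noncrossing"
      unfolding noncrossing_def
    proof (intro CollectI conjI allI impI g')
      fix p q assume "cross p q"
      show "g' p = 0 \<or> g' q = 0"
      proof (rule ccontr)
        assume "\<not> ?thesis"
        with uncross_step[OF g'(1) \<open>cross p q\<close>] least g'(2) show False
          by (metis not_less)
      qed
    qed
    then show ?thesis using g'(2) by (metis imageI)
  qed
  then have "margins ` noncrossing = margins ` arrays"
    by (auto simp: noncrossing_def)
  then show ?thesis using inj_on_margins by (simp add: bij_betw_def)
qed

end

section \<open>Principal specialisation of complete homogeneous sums at roots of unity\<close>

section \<open>Complete homogeneous polynomials at roots of unity\<close>

text \<open>Weak compositions: zero parts are allowed. Extensionality outside \<open>I\<close>
  counts each of them once.\<close>

definition compositions :: "'i set \<Rightarrow> nat \<Rightarrow> ('i \<Rightarrow> nat) set" where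
  "compositions I a = {f \<in> I \<rightarrow>\<^sub>E UNIV. sum f I = a}"

definition complete_hom :: "'i set \<Rightarrow> ('i \<Rightarrow> 'a::comm_semiring_1) \<Rightarrow> nat \<Rightarrow> 'a" where
  "complete_hom I x a = (\<Sum>f\<in>compositions I a. \<Prod>i\<in>I. x i ^ f i)"

lemma finite_compositions:
  assumes "finite I" shows "finite (compositions I a)"
proof (rule finite_subset)
  show "compositions I a \<subseteq> I \<rightarrow>\<^sub>E {..a}"
  proof
    fix f assume "f \<in> compositions I a"
    then have "f \<in> extensional I" "sum f I = a" by (auto simp: compositions_def PiE_iff)
    with assms show "f \<in> I \<rightarrow>\<^sub>E {..a}"
      using member_le_sum[of _ I f] by (auto simp: PiE_iff)
  qed
qed (use assms in \<open>auto intro: finite_PiE\<close>)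

text \<open>Splits off the exponent \<open>r\<close> of one variable; both the recurrence for
  \<open>complete_hom\<close> and the branching rule for \<open>ballot_sum\<close> come from
  it.\<close>

lemma sum_compositions_insert:
  assumes "finite I" "j \<notin> I"
  shows "(\<Sum>f\<in>compositions (insert j I) a. F f) =
    (\<Sum>r\<le>a. \<Sum>f\<in>compositions I (a - r). F (f(j := r)))"
proof -
  have "(\<Sum>r\<le>a. \<Sum>f\<in>compositions I (a - r). F (f(j := r))) =
    (\<Sum>(r, f)\<in>Sigma {..a} (\<lambda>r. compositions I (a - r)). F (f(j := r)))"
    by (rule sum.Sigma) (use assms in \<open>auto simp: finite_compositions\<close>)
  also have "\<dots> = (\<Sum>f\<in>compositions (insert j I) a. F f)"
  proof (rule sum.reindex_bij_witness[where j = "\<lambda>(r, f). f(j := r)" and i = "\<lambda>f. (f j, restrict f I)"],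
      goal_cases)
    case (1 u)
    then obtain r f where u: "u = (r, f)" "r \<le> a" "f \<in> I \<rightarrow>\<^sub>E UNIV" by (auto simp: compositions_def)
    then have "restrict (f(j := r)) I = f"
      using assms by (auto simp: fun_eq_iff PiE_iff extensional_def restrict_def)
    then show ?case using u by simp
  next
    case (2 u)
    then obtain r f where u: "u = (r, f)" "r \<le> a" "f \<in> compositions I (a - r)" by auto
    moreover have "sum (f(j := r)) I = sum f I"
      by (rule sum.cong) (use assms in auto)
    ultimately show ?case
      using assms by (auto simp: compositions_def PiE_iff extensional_def)
  next
    case (3 f)
    then show ?case using assms by (auto simp: compositions_def fun_eq_iff PiE_iff extensional_def restrict_def)
  next
    case (4 f)
    then show ?case using assms by (auto simp: compositions_def)
  qed auto
  finally show ?thesis ..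
qed

lemma complete_hom_insert:
  assumes "finite I" "j \<notin> I"
  shows "complete_hom (insert j I) x a = (\<Sum>r\<le>a. x j ^ r * complete_hom I x (a - r))"
proof -
  have "(\<Prod>i\<in>I. x i ^ (f(j := r)) i) = (\<Prod>i\<in>I. x i ^ f i)" for f r
    by (rule prod.cong) (use assms in auto)
  then show ?thesis
    using assms by (simp add: complete_hom_def sum_compositions_insert sum_distrib_left)
qed

lemma compositions_empty: "compositions {} a = (if a = 0 then {\<lambda>_. undefined} else {})"
  by (auto simp: compositions_def)

lemma complete_hom_empty: "complete_hom {} x a = (if a = 0 then 1 else 0)"
  by (simp add: complete_hom_def compositions_empty)

lemma complete_hom_one: "complete_hom I (\<lambda>_. 1) a = of_nat (card (compositions I a))"
  by (simp add: complete_hom_def)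

definition complete_hom_fps :: "'i set \<Rightarrow> ('i \<Rightarrow> 'a::comm_ring_1) \<Rightarrow> 'a fps" where
  "complete_hom_fps I x = Abs_fps (complete_hom I x)"

lemma fps_geometric_mult: "Abs_fps (\<lambda>r. (c::'a::comm_ring_1) ^ r) * (1 - fps_const c * fps_X) = 1"
proof (rule fps_ext)
  fix n
  let ?G = "Abs_fps (\<lambda>r. c ^ r)"
  have "?G * (1 - fps_const c * fps_X) = ?G - ?G * fps_const c * fps_X"
    by (simp only: right_diff_distrib mult_1_right mult.assoc)
  then show "(Abs_fps (\<lambda>r. c ^ r) * (1 - fps_const c * fps_X)) $ n = (1::'a fps) $ n"
    by (cases n) simp_all
qed

text \<open>The classical \<open>H(X) E(-X) = 1\<close>, each variable contributing a geometric
  series. A product form suits coefficients in a mere commutative ring.\<close>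

lemma complete_hom_fps_mult:
  assumes "finite I"
  shows "complete_hom_fps I x * (\<Prod>i\<in>I. 1 - fps_const (x i) * fps_X) = (1 :: 'a::comm_ring_1 fps)"
  using assms
proof (induction I rule: finite_induct)
  case empty
  then show ?case by (auto simp: complete_hom_fps_def complete_hom_empty fps_eq_iff)
next
  case (insert j I)
  have "complete_hom_fps (insert j I) x = Abs_fps (\<lambda>r. x j ^ r) * complete_hom_fps I x"
    using insert by (auto simp: fps_eq_iff complete_hom_fps_def fps_mult_nth complete_hom_insert
        atLeast0AtMost)
  then have "complete_hom_fps (insert j I) x * (\<Prod>i\<in>insert j I. 1 - fps_const (x i) * fps_X) =
     (Abs_fps (\<lambda>r. x j ^ r) * (1 - fps_const (x j) * fps_X)) *
     (complete_hom_fps I x * (\<Prod>i\<in>I. 1 - fps_const (x i) * fps_X))"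
    by (simp only: prod.insert[OF insert.hyps] mult_ac)
  also have "\<dots> = 1" by (simp only: fps_geometric_mult insert.IH mult_1)
  finally show ?case .
qed

text \<open>Replacing \<open>X\<close> by \<open>q X\<close> permutes the factors cyclically, so the
  coefficient in degree \<open>j\<close> can be nonzero only if \<open>q ^ j = 1\<close>. Up to the
  degree bound this leaves \<open>0\<close> and \<open>m\<close>, and the root \<open>1\<close>
  fixes the leading coefficient.\<close>

lemma prod_one_minus_root_powers:
  assumes "root_of_unity_of_order m q"
  shows "(\<Prod>i<m. [:1, - (q ^ i):]) = 1 - monom 1 m"
proof -
  define E where "E = (\<Prod>i<m. [:1, - (q ^ i):])"
  have m: "m > 0" "q ^ m = 1" and ne: "\<And>j. 0 < j \<Longrightarrow> j < m \<Longrightarrow> q ^ j \<noteq> 1"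
    using assms by (auto simp: root_of_unity_of_order_def)
  have "pcompose E [:0, q:] = (\<Prod>i<m. [:1, - (q ^ Suc i):])"
    by (simp add: E_def pcompose_prod pcompose_pCons mult.commute)
  also have "\<dots> = E"
  proof -
    obtain l where l: "m = Suc l" using m by (cases m) auto
    have "(\<Prod>i<Suc l. [:1, - (q ^ Suc i):]) = (\<Prod>i<l. [:1, - (q ^ Suc i):]) * [:1, - (q ^ m):]"
      by (simp add: l)
    also have "\<dots> = [:1, - (q ^ 0):] * (\<Prod>i<l. [:1, - (q ^ Suc i):])"
      using m(2) by (simp only: power_0 mult.commute)
    also have "\<dots> = E" unfolding E_def l prod.lessThan_Suc_shift by (simp add: o_def)
    finally show ?thesis unfolding l .
  qed
  finally have "pcompose E [:0, q:] = E" .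
  then have c: "q ^ j * coeff E j = coeff E j" for j
    using coeff_pcompose_linear[of E q j] by simp
  have deg: "degree E \<le> m"
    unfolding E_def using degree_prod_sum_le[of "{..<m}" "\<lambda>i. [:1, - (q ^ i):]"]
    by (rule order_trans) (auto intro!: order_trans[OF sum_bounded_above[where K = 1]])
  have mid: "coeff E j = 0" if "0 < j" "j \<noteq> m" for j
  proof (cases "j < m")
    case True
    with c[of j] ne[of j] that show ?thesis by auto
  next
    case False
    with deg that show ?thesis by (intro coeff_eq_0) auto
  qed
  have c0: "coeff E 0 = 1"
    unfolding poly_0_coeff_0[symmetric] E_def by (simp add: poly_prod)
  have "E = 1 + monom (coeff E m) m"
    using mid c0 m by (intro poly_eqI) (auto simp: coeff_1)
  moreover have "poly E 1 = 0"
    unfolding E_def poly_prod using m by (intro prod_zero) (auto intro!: bexI[of _ 0])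
  ultimately have "coeff E m = -1"
    by (metis (no_types, lifting) add_eq_0_iff poly_1 poly_add poly_monom power_one mult.right_neutral)
  with \<open>E = 1 + monom (coeff E m) m\<close> show ?thesis
    by (simp add: E_def minus_monom[symmetric])
qed

lemma fps_compose_fps_X_power_nth:
  assumes "m > 0"
  shows "(G oo fps_X ^ m) $ a = (if m dvd a then G $ (a div m) else (0::'a::comm_ring_1))"
proof -
  have "(G oo fps_X ^ m) $ a = (\<Sum>i=0..a. if a = m * i then G $ i else 0)"
    by (auto simp: fps_compose_nth power_mult[symmetric] intro!: sum.cong)
  also have "\<dots> = (if m dvd a then G $ (a div m) else 0)"
  proof (cases "m dvd a")
    case True
    then obtain b where b: "a = m * b" by auto
    then have "(\<Sum>i=0..a. if a = m * i then G $ i else 0) = (\<Sum>i=0..a. if i = b then G $ i else 0)"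
      using assms by (intro sum.cong) auto
    also have "\<dots> = G $ b" using b assms by simp
    finally show ?thesis using b assms by simp
  next
    case False
    then show ?thesis by (auto intro!: sum.neutral)
  qed
  finally show ?thesis .
qed

lemma inverse_unique_comm:
  fixes a b c :: "'a::comm_monoid_mult"
  assumes "a * c = 1" "b * c = 1"
  shows "a = b"
proof -
  have "a = a * (b * c)" using assms by simp
  also have "\<dots> = b * (a * c)" by (simp only: mult_ac)
  finally show ?thesis using assms by simp
qed

lemma prod_lessThan_add:
  "(\<Prod>i<a + b. f i) = (\<Prod>i<a. f i) * (\<Prod>i<(b::nat). f (a + i) :: 'a::comm_monoid_mult)"
  by (induction b) (simp_all add: mult_ac)

text \<open>Both series are inverse to the same power of \<open>1 - X^m\<close>: the
  \<open>n\<close> powers of \<open>q\<close> form \<open>card J\<close> full periods, and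
  \<open>card J\<close> variables equal to 1 give a power of \<open>1 - X\<close>, in which
  \<open>X^m\<close> is substituted. The set \<open>J\<close> stays arbitrary so that the residues
  modulo \<open>N\<close> can be inserted.\<close>

lemma complete_hom_root_of_unity:
  assumes q: "root_of_unity_of_order m q" and J: "finite J" and n: "n = m * card J"
  shows "complete_hom {1..n} (\<lambda>i. q ^ (i - 1)) a =
    (if m dvd a then of_nat (card (compositions J (a div m))) else 0)"
proof -
  have m: "m > 0" "q ^ m = 1" using q by (auto simp: root_of_unity_of_order_def)
  have "fps_of_poly (\<Prod>i<m. [:1, - (q ^ i):]) = fps_of_poly (1 - monom 1 m)"
    using prod_one_minus_root_powers[OF q] by simp
  moreover have "fps_of_poly [:1, - c:] = 1 - fps_const c * fps_X" for c :: complex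
    by (simp add: fps_of_poly_pCons flip: fps_const_neg)
  ultimately have base: "(\<Prod>i<m. 1 - fps_const (q ^ i) * fps_X) = 1 - fps_X ^ m"
    by (simp add: fps_of_poly_prod fps_of_poly_diff fps_of_poly_monom')
  have "(\<Prod>i<m * N. 1 - fps_const (q ^ i) * fps_X) = (1 - fps_X ^ m) ^ N" for N
  proof (induction N)
    case (Suc N)
    have "(\<Prod>i<m * Suc N. 1 - fps_const (q ^ i) * fps_X) =
      (\<Prod>i<m * N. 1 - fps_const (q ^ i) * fps_X) * (\<Prod>i<m. 1 - fps_const (q ^ (m * N + i)) * fps_X)"
      by (simp only: mult_Suc_right add.commute[of m] prod_lessThan_add)
    then show ?case using Suc base m by (simp add: power_add power_mult)
  qed simp
  moreover have "(\<Prod>i\<in>{1..n}. 1 - fps_const (q ^ (i - 1)) * fps_X) =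
     (\<Prod>i<n. 1 - fps_const (q ^ i) * fps_X)"
    by (rule prod.reindex_bij_witness[of _ Suc "\<lambda>i. i - 1"]) auto
  ultimately have A: "complete_hom_fps {1..n} (\<lambda>i. q ^ (i - 1)) * (1 - fps_X ^ m) ^ card J = 1"
    using complete_hom_fps_mult[of "{1..n}" "\<lambda>i. q ^ (i - 1)"] n by simp
  define G where "G = complete_hom_fps J (\<lambda>_. 1 :: complex)"
  have "G * (1 - fps_X) ^ card J = 1"
    using complete_hom_fps_mult[OF J, of "\<lambda>_. 1 :: complex"] by (simp add: G_def)
  then have "(G * (1 - fps_X) ^ card J) oo fps_X ^ m = 1 oo fps_X ^ m" by simp
  then have B: "(G oo fps_X ^ m) * (1 - fps_X ^ m) ^ card J = 1"
    using m by (simp add: fps_compose_mult_distrib fps_compose_power[symmetric] fps_compose_sub_distrib)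
  have "complete_hom_fps {1..n} (\<lambda>i. q ^ (i - 1)) = G oo fps_X ^ m"
    using inverse_unique_comm[OF A B] .
  then have "complete_hom_fps {1..n} (\<lambda>i. q ^ (i - 1)) $ a = (G oo fps_X ^ m) $ a" by simp
  then show ?thesis
    using fps_compose_fps_X_power_nth[OF m(1), of G a]
    by (simp add: complete_hom_fps_def G_def complete_hom_one)
qed

section \<open>Two-row Schur polynomials: branching, determinant, contents of tableaux\<close>

section \<open>Schur polynomials of two equal rows\<close>

text \<open>The range \<open>{1..<t}\<close> is strict: an arc closing at \<open>t\<close> must open
  before \<open>t\<close>, just as the columns of a tableau increase strictly.\<close>

definition ballot_pair :: "nat \<Rightarrow> (nat \<Rightarrow> nat) \<Rightarrow> (nat \<Rightarrow> nat) \<Rightarrow> bool" where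
  "ballot_pair n f g \<longleftrightarrow> (\<forall>t\<in>{1..n}. sum g {1..t} \<le> sum f {1..<t})"

definition ballot_pairs :: "nat \<Rightarrow> nat \<Rightarrow> ((nat \<Rightarrow> nat) \<times> (nat \<Rightarrow> nat)) set" where
  "ballot_pairs n k = {(f, g) \<in> compositions {1..n} k \<times> compositions {1..n} k. ballot_pair n f g}"

text \<open>Unequal totals \<open>a\<close> and \<open>b\<close> make induction on \<open>n\<close>
  possible, since removing the largest letter may shorten the two rows by different amounts.\<close>

definition ballot_sum :: "nat \<Rightarrow> (nat \<Rightarrow> 'a::comm_semiring_1) \<Rightarrow> nat \<Rightarrow> nat \<Rightarrow> 'a" where
  "ballot_sum n x a b = (\<Sum>f\<in>compositions {1..n} a. \<Sum>g\<in>compositions {1..n} b.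
     if ballot_pair n f g then (\<Prod>i=1..n. x i ^ f i) * (\<Prod>i=1..n. x i ^ g i) else 0)"

text \<open>Letter \<open>n + 1\<close> adds only the condition at \<open>t = n + 1\<close>. There
  the strict sum omits the new value \<open>r\<close>, so it reads
  \<open>b \<le> a - r\<close>.\<close>

lemma ballot_pair_Suc:
  assumes f: "f \<in> compositions {1..n} (a - r)" and g: "g \<in> compositions {1..n} (b - s)"
    and "r \<le> a" "s \<le> b"
  shows "ballot_pair (Suc n) (f(Suc n := r)) (g(Suc n := s)) \<longleftrightarrow> ballot_pair n f g \<and> b + r \<le> a"
proof -
  have 1: "sum (g(Suc n := s)) {1..t} = sum g {1..t}" if "t \<le> n" for t
    by (rule sum.cong) (use that in auto)
  have 2: "sum (f(Suc n := r)) {1..<t} = sum f {1..<t}" if "t \<le> Suc n" for t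
    by (rule sum.cong) (use that in auto)
  have 3: "sum (g(Suc n := s)) {1..Suc n} = b"
    using assms 1[of n] by (simp add: compositions_def)
  have 4: "sum f {1..<Suc n} = a - r"
    using f by (simp add: compositions_def atLeastLessThanSuc_atLeastAtMost)
  have "{1..Suc n} = insert (Suc n) {1..n}" by auto
  then have "ballot_pair (Suc n) (f(Suc n := r)) (g(Suc n := s)) \<longleftrightarrow>
    sum (g(Suc n := s)) {1..Suc n} \<le> sum (f(Suc n := r)) {1..<Suc n} \<and>
    (\<forall>t\<in>{1..n}. sum (g(Suc n := s)) {1..t} \<le> sum (f(Suc n := r)) {1..<t})"
    by (simp only: ballot_pair_def ball_simps)
  also have "\<dots> \<longleftrightarrow> b \<le> a - r \<and> ballot_pair n f g"
    unfolding 3 2[OF order_refl] 4 ballot_pair_def using 1 2 by (intro conj_cong ball_cong) auto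
  finally show ?thesis using \<open>r \<le> a\<close> by auto
qed

text \<open>The branching rule: the letters \<open>n + 1\<close> form a horizontal strip,
  \<open>r\<close> of them ending the first row and \<open>s\<close> the second, and
  \<open>b + r \<le> a\<close> keeps them in distinct columns.\<close>

lemma ballot_sum_Suc:
  "ballot_sum (Suc n) x a b = (\<Sum>r\<le>a. \<Sum>s\<le>b.
     if b + r \<le> a then x (Suc n) ^ r * x (Suc n) ^ s * ballot_sum n x (a - r) (b - s) else 0)"
proof -
  have ins: "{1..Suc n} = insert (Suc n) {1..n}" by auto
  have P: "(\<Prod>i=1..Suc n. x i ^ (f(Suc n := r)) i) = x (Suc n) ^ r * (\<Prod>i=1..n. x i ^ f i)" for f r
  proof -
    have "(\<Prod>i=1..n. x i ^ (f(Suc n := r)) i) = (\<Prod>i=1..n. x i ^ f i)"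
      by (rule prod.cong) auto
    then show ?thesis unfolding ins by (subst prod.insert) auto
  qed
  have "ballot_sum (Suc n) x a b =
    (\<Sum>r\<le>a. \<Sum>f\<in>compositions {1..n} (a - r). \<Sum>s\<le>b. \<Sum>g\<in>compositions {1..n} (b - s).
      if ballot_pair (Suc n) (f(Suc n := r)) (g(Suc n := s))
      then (\<Prod>i=1..Suc n. x i ^ (f(Suc n := r)) i) * (\<Prod>i=1..Suc n. x i ^ (g(Suc n := s)) i) else 0)"
    unfolding ballot_sum_def unfolding ins by (subst sum_compositions_insert, simp, simp)+ simp
  also have "\<dots> = (\<Sum>r\<le>a. \<Sum>f\<in>compositions {1..n} (a - r). \<Sum>s\<le>b. \<Sum>g\<in>compositions {1..n} (b - s).
      if b + r \<le> a then x (Suc n) ^ r * x (Suc n) ^ s * (if ballot_pair n f g then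
       (\<Prod>i=1..n. x i ^ f i) * (\<Prod>i=1..n. x i ^ g i) else 0) else 0)"
    unfolding P by (intro sum.cong refl) (auto simp: ballot_pair_Suc mult_ac)
  also have "\<dots> = (\<Sum>r\<le>a. \<Sum>s\<le>b. \<Sum>f\<in>compositions {1..n} (a - r). \<Sum>g\<in>compositions {1..n} (b - s).
      if b + r \<le> a then x (Suc n) ^ r * x (Suc n) ^ s * (if ballot_pair n f g then
       (\<Prod>i=1..n. x i ^ f i) * (\<Prod>i=1..n. x i ^ g i) else 0) else 0)"
    by (intro sum.cong refl sum.swap)
  also have "\<dots> = (\<Sum>r\<le>a. \<Sum>s\<le>b.
     if b + r \<le> a then x (Suc n) ^ r * x (Suc n) ^ s * ballot_sum n x (a - r) (b - s) else 0)"
    by (intro sum.cong refl) (simp add: ballot_sum_def sum_distrib_left)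
  finally show ?thesis .
qed

text \<open>The branching rule cuts the sum over \<open>r\<close> at \<open>c = a - b\<close>. The
  missing tail carries a factor \<open>x j ^ Suc c\<close> and is again a complete sum.\<close>

lemma complete_hom_split:
  assumes "finite I" "j \<notin> I"
  shows "complete_hom (insert j I) x (c + Suc e) =
    (\<Sum>r\<le>c. x j ^ r * complete_hom I x (c + Suc e - r)) +
    x j ^ Suc c * complete_hom (insert j I) x e"
proof -
  have "complete_hom (insert j I) x (c + Suc e) =
    (\<Sum>r\<le>c + Suc e. x j ^ r * complete_hom I x (c + Suc e - r))"
    by (rule complete_hom_insert[OF assms])
  also have "\<dots> = (\<Sum>r\<in>{..c} \<union> {Suc c..c + Suc e}. x j ^ r * complete_hom I x (c + Suc e - r))"
    by (rule arg_cong2[where f = sum]) auto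
  also have "\<dots> = (\<Sum>r\<le>c. x j ^ r * complete_hom I x (c + Suc e - r)) +
     (\<Sum>r\<in>{Suc c..c + Suc e}. x j ^ r * complete_hom I x (c + Suc e - r))"
    by (rule sum.union_disjoint) auto
  also have "(\<Sum>r\<in>{Suc c..c + Suc e}. x j ^ r * complete_hom I x (c + Suc e - r)) =
     (\<Sum>r\<le>e. x j ^ (Suc c + r) * complete_hom I x (e - r))"
    by (rule sum.reindex_bij_witness[of _ "\<lambda>r. Suc c + r" "\<lambda>r. r - Suc c"]) (auto simp: add.commute[of e c])
  also have "\<dots> = x j ^ Suc c * complete_hom (insert j I) x e"
    by (simp add: complete_hom_insert[OF assms] sum_distrib_left power_add mult_ac)
  finally show ?thesis .
qed

text \<open>The Jacobi--Trudi identity for two rows.\<close>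

lemma ballot_sum_eq:
  fixes x :: "nat \<Rightarrow> 'a::comm_ring_1"
  assumes "b \<le> a"
  shows "ballot_sum n x a b = complete_hom {1..n} x a * complete_hom {1..n} x b -
    complete_hom {1..n} x (Suc a) * (if b = 0 then 0 else complete_hom {1..n} x (b - 1))"
  using assms
proof (induction n arbitrary: a b)
  case 0
  then show ?case by (auto simp: ballot_sum_def compositions_empty complete_hom_empty ballot_pair_def)
next
  case (Suc n)
  define h where "h = complete_hom {1..n} x"
  define H where "H = complete_hom {1..Suc n} x"
  \<comment> \<open>The complete sum of degree \<open>j - 1\<close>, with value 0 in degree
    \<open>-1\<close>, so that no case split occurs under the double sum.\<close>
  define h' where "h' j = (if j = 0 then 0 else h (j - 1))" for j
  define z where "z = x (Suc n)"
  define c where "c = a - b"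
  define A where "A = (\<Sum>r\<le>c. z ^ r * h (a - r))"
  define A' where "A' = (\<Sum>r\<le>c. z ^ r * h (Suc a - r))"
  have ins: "{1..Suc n} = insert (Suc n) {1..n}" by auto
  have H: "H j = (\<Sum>r\<le>j. z ^ r * h (j - r))" for j
    unfolding H_def ins h_def z_def by (rule complete_hom_insert) auto
  have split: "H (c + Suc e) = (\<Sum>r\<le>c. z ^ r * h (c + Suc e - r)) + z ^ Suc c * H e" for e
    unfolding H_def ins h_def z_def by (rule complete_hom_split) auto
  have a: "a = c + b" using Suc.prems by (simp add: c_def)
  have H': "(\<Sum>s\<le>b. z ^ s * h' (b - s)) = (if b = 0 then 0 else H (b - 1))"
  proof (cases b)
    case (Suc d)
    have "(\<Sum>s\<le>Suc d. z ^ s * h' (Suc d - s)) = (\<Sum>s\<le>d. z ^ s * h' (Suc d - s))"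
      by (simp add: h'_def)
    also have "\<dots> = (\<Sum>s\<le>d. z ^ s * h (d - s))"
      by (intro sum.cong) (auto simp: h'_def)
    finally show ?thesis using Suc H by simp
  qed (simp add: h'_def)
  have "ballot_sum (Suc n) x a b = (\<Sum>r\<le>a. if r \<le> c then
     (\<Sum>s\<le>b. z ^ r * z ^ s * ballot_sum n x (a - r) (b - s)) else 0)"
    unfolding ballot_sum_Suc z_def by (intro sum.cong refl) (auto simp: a)
  also have "\<dots> = (\<Sum>r\<le>c. \<Sum>s\<le>b. z ^ r * z ^ s * ballot_sum n x (a - r) (b - s))"
    by (subst sum.inter_filter[symmetric]) (auto intro!: sum.cong simp: a)
  also have "\<dots> = (\<Sum>r\<le>c. \<Sum>s\<le>b. (z ^ r * h (a - r)) * (z ^ s * h (b - s)) -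
      (z ^ r * h (Suc a - r)) * (z ^ s * h' (b - s)))"
  proof (intro sum.cong refl)
    fix r s assume rs: "r \<in> {..c}" "s \<in> {..b}"
    then have *: "b - s \<le> a - r" "Suc (a - r) = Suc a - r" using a by auto
    have e: "ballot_sum n x (a - r) (b - s) = h (a - r) * h (b - s) - h (Suc a - r) * h' (b - s)"
      using Suc.IH[OF *(1)] by (simp only: h_def h'_def *(2))
    show "z ^ r * z ^ s * ballot_sum n x (a - r) (b - s) =
      (z ^ r * h (a - r)) * (z ^ s * h (b - s)) - (z ^ r * h (Suc a - r)) * (z ^ s * h' (b - s))"
      unfolding e by (simp only: algebra_simps)
  qed
  also have "\<dots> = A * H b - A' * (\<Sum>s\<le>b. z ^ s * h' (b - s))"
    unfolding A_def A'_def H sum_product by (simp add: sum_subtractf)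
  also have "\<dots> = A * H b - A' * (if b = 0 then 0 else H (b - 1))"
    by (simp only: H')
  also have "\<dots> = H a * H b - H (Suc a) * (if b = 0 then 0 else H (b - 1))"
  proof -
    \<comment> \<open>For \<open>b > 0\<close> the cut costs \<open>z ^ Suc c * H b\<close> in
      \<open>H (Suc a)\<close> and \<open>z ^ Suc c * H (b - 1)\<close> in \<open>H a\<close>; the
      two losses cancel in the determinant.\<close>
    have 1: "H (Suc a) = A' + z ^ Suc c * H b" using split[of b] by (simp add: A'_def a)
    show ?thesis
    proof (cases b)
      case 0
      then show ?thesis by (simp add: A_def H a)
    next
      case (Suc d)
      then have "H a = A + z ^ Suc c * H d" using split[of d] by (simp add: A_def a)
      then show ?thesis using 1 Suc by (simp add: algebra_simps)
    qed
  qed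
  finally show ?case by (simp add: H_def)
qed

section \<open>Tableau rows as increasing words\<close>

text \<open>The weakly increasing word in which the letter \<open>i\<close> occurs \<open>f i\<close> times.\<close>

definition increasing_word :: "(nat \<Rightarrow> nat) \<Rightarrow> nat \<Rightarrow> nat" where
  "increasing_word f s = (LEAST t. s < sum f {1..t})"

text \<open>A Galois connection between letters and positions, which lets the word be handled
  through partial sums instead of through \<open>LEAST\<close>.\<close>

lemma increasing_word_le_iff:
  assumes f: "f \<in> compositions {1..n} k" and s: "s < k"
  shows "increasing_word f s \<le> t \<longleftrightarrow> s < sum f {1..t}"
proof
  have "s < sum f {1..n}" using assms by (simp add: compositions_def)
  then have "s < sum f {1..increasing_word f s}"
    unfolding increasing_word_def by (rule LeastI)
  also assume "increasing_word f s \<le> t"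
  then have "sum f {1..increasing_word f s} \<le> sum f {1..t}"
    by (intro sum_mono2) auto
  finally show "s < sum f {1..t}" .
qed (simp add: increasing_word_def Least_le)

lemma increasing_word_in:
  assumes "f \<in> compositions {1..n} k" "s < k"
  shows "increasing_word f s \<in> {1..n}"
proof -
  have "\<not> increasing_word f s \<le> 0" using increasing_word_le_iff[OF assms, of 0] by simp
  moreover have "increasing_word f s \<le> n"
    using assms increasing_word_le_iff[OF assms, of n] by (simp add: compositions_def)
  ultimately show ?thesis unfolding atLeastAtMost_iff by linarith
qed

text \<open>The positions of letter \<open>i\<close> form the interval between two consecutive
  partial sums.\<close>

lemma card_increasing_word_eq:
  assumes f: "f \<in> compositions {1..n} k" and i: "i \<in> {1..n}"
  shows "card {s. s < k \<and> increasing_word f s = i} = f i"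
proof -
  obtain j where j: "i = Suc j" using i by (cases i) auto
  have "sum f {1..i} \<le> sum f {1..n}" using i by (intro sum_mono2) auto
  then have le: "sum f {1..i} \<le> k" using f by (simp add: compositions_def)
  have "s < k \<and> increasing_word f s = i \<longleftrightarrow> sum f {1..j} \<le> s \<and> s < sum f {1..i}" for s
  proof (cases "s < k")
    case True
    have "increasing_word f s = i \<longleftrightarrow> increasing_word f s \<le> i \<and> \<not> increasing_word f s \<le> j"
      unfolding j by linarith
    also have "\<dots> \<longleftrightarrow> s < sum f {1..i} \<and> \<not> s < sum f {1..j}"
      by (simp only: increasing_word_le_iff[OF f True])
    finally show ?thesis using True by linarith
  qed (use le in auto)
  then have "{s. s < k \<and> increasing_word f s = i} = {sum f {1..j}..<sum f {1..i}}"
    unfolding atLeastLessThan_def lessThan_def atLeast_def by blast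
  then have "card {s. s < k \<and> increasing_word f s = i} = sum f {1..i} - sum f {1..j}"
    by (simp only: card_atLeastLessThan)
  also have "\<dots> = f i" by (simp add: j)
  finally show ?thesis .
qed

text \<open>The positions with letter at most \<open>t\<close> form an initial segment, so
  membership in it is decided by its cardinality, which is a partial sum of the content.\<close>

lemma increasing_word_card:
  assumes u: "\<And>s. s < k \<Longrightarrow> u s \<in> {1..n}" and mono: "\<And>s s'. s < s' \<Longrightarrow> s' < k \<Longrightarrow> u s \<le> u s'"
    and s: "s < k"
  shows "increasing_word (\<lambda>i\<in>{1..n}. card {s. s < k \<and> u s = i}) s = u s"
proof -
  define f where "f = (\<lambda>i\<in>{1..n}. card {s. s < k \<and> u s = i})"
  have cum: "s < sum f {1..t} \<longleftrightarrow> u s \<le> t" if t: "t \<le> n" for t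
  proof -
    define Z where "Z = {s. s < k \<and> u s \<le> t}"
    have "sum f {1..t} = (\<Sum>i=1..t. card {s. s < k \<and> u s = i})"
      using t by (intro sum.cong) (auto simp: f_def)
    also have "\<dots> = card (\<Union>i\<in>{1..t}. {s. s < k \<and> u s = i})"
      by (rule card_UN_disjoint[symmetric]) auto
    also have "(\<Union>i\<in>{1..t}. {s. s < k \<and> u s = i}) = Z"
      using u by (force simp: Z_def)
    finally have sum: "sum f {1..t} = card Z" .
    have down: "r \<in> Z" if "r \<le> r'" "r' \<in> Z" for r r'
      using that mono[of r r'] by (cases "r = r'") (auto simp: Z_def)
    have fin: "finite Z" by (simp add: Z_def)
    have "s < card Z \<longleftrightarrow> s \<in> Z"
    proof
      assume "s < card Z"
      show "s \<in> Z"
      proof (rule ccontr)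
        assume "s \<notin> Z"
        then have "Z \<subseteq> {..<s}" using down by (meson lessThan_iff not_le subsetI)
        then have "card Z \<le> s" using card_mono[of "{..<s}" Z] by simp
        with \<open>s < card Z\<close> show False by simp
      qed
    next
      assume "s \<in> Z"
      then have "{..s} \<subseteq> Z" using down by auto
      then have "card {..s} \<le> card Z" using fin by (rule card_mono[rotated])
      then show "s < card Z" by simp
    qed
    with sum s show ?thesis by (simp add: Z_def)
  qed
  have "increasing_word f s = u s"
    unfolding increasing_word_def
  proof (rule Least_equality)
    show "s < sum f {1..u s}" using cum[of "u s"] u[OF s] by simp
    fix t assume "s < sum f {1..t}"
    then show "u s \<le> t" using cum[of t] u[OF s] by (cases "t \<le> n") auto
  qed
  then show ?thesis by (simp add: f_def)
qed

text \<open>Comparing letters becomes comparing partial sums. The predecessor \<open>j\<close> of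
  \<open>t\<close> turns the strict inequality of letters into the strict upper limit in
  \<open>ballot_pair\<close>.\<close>

lemma increasing_word_less_iff_ballot:
  assumes f: "f \<in> compositions {1..n} k" and g: "g \<in> compositions {1..n} k"
  shows "(\<forall>s<k. increasing_word f s < increasing_word g s) \<longleftrightarrow> ballot_pair n f g"
proof
  assume lt: "\<forall>s<k. increasing_word f s < increasing_word g s"
  show "ballot_pair n f g" unfolding ballot_pair_def
  proof
    fix t assume t: "t \<in> {1..n}"
    then obtain j where j: "t = Suc j" by (cases t) auto
    have "sum g {1..t} \<le> sum g {1..n}" using t by (intro sum_mono2) auto
    then have le: "sum g {1..t} \<le> k" using g by (simp add: compositions_def)
    have "s < sum f {1..j}" if s: "s < sum g {1..t}" for s
    proof -
      have k: "s < k" using s le by simp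
      have "increasing_word g s \<le> t" using increasing_word_le_iff[OF g k] s by simp
      then have "increasing_word f s \<le> j" using lt k j by fastforce
      then show ?thesis using increasing_word_le_iff[OF f k] by simp
    qed
    then have "sum g {1..t} \<le> sum f {1..j}" by (meson not_le order_refl)
    then show "sum g {1..t} \<le> sum f {1..<t}" by (simp add: j atLeastLessThanSuc_atLeastAtMost)
  qed
next
  assume b: "ballot_pair n f g"
  show "\<forall>s<k. increasing_word f s < increasing_word g s"
  proof (intro allI impI)
    fix s assume s: "s < k"
    define t where "t = increasing_word g s"
    have t: "t \<in> {1..n}" using increasing_word_in[OF g s] by (simp add: t_def)
    then obtain j where j: "t = Suc j" by (cases t) auto
    have "s < sum g {1..t}" using increasing_word_le_iff[OF g s, of t] by (simp add: t_def)
    also have "\<dots> \<le> sum f {1..<t}" using b t by (simp add: ballot_pair_def)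
    finally have "s < sum f {1..j}" by (simp add: j atLeastLessThanSuc_atLeastAtMost)
    then have "increasing_word f s \<le> j" using increasing_word_le_iff[OF f s] by simp
    then show "increasing_word f s < increasing_word g s" using j t_def by simp
  qed
qed

definition row_content :: "nat \<Rightarrow> nat \<Rightarrow> (nat \<times> nat \<Rightarrow> nat) \<Rightarrow> nat \<Rightarrow> nat \<Rightarrow> nat" where
  "row_content n k T r = (\<lambda>i\<in>{1..n}. card {s. s < k \<and> T (r, s) = i})"

lemma cells_two_rows: "cells [k, k] = {(r, s). r < 2 \<and> s < k}"
proof -
  have nth: "[k, k] ! r = k" if "r < 2" for r using less_2_cases[OF that] by auto
  have len: "length [k, k] = 2" by simp
  show ?thesis unfolding cells_def len using nth by (intro Collect_cong) force
qed

lemma semistandard_tableaux_two_rows: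
  "T \<in> semistandard_tableaux [k, k] n \<longleftrightarrow> T \<in> {(r, s). r < 2 \<and> s < k} \<rightarrow>\<^sub>E {1..n} \<and>
     (\<forall>r s s'. r < 2 \<and> s < s' \<and> s' < k \<longrightarrow> T (r, s) \<le> T (r, s')) \<and>
     (\<forall>s<k. T (0, s) < T (1, s))"
proof -
  have "r < r' \<and> r' < 2 \<longleftrightarrow> r = 0 \<and> r' = 1" for r r' :: nat by linarith
  then have "(r, s) \<in> cells [k, k] \<and> (r', s) \<in> cells [k, k] \<and> r < r' \<longleftrightarrow> r = 0 \<and> r' = 1 \<and> s < k"
    for r r' s unfolding cells_two_rows by auto
  then have "(\<forall>r r' s. (r, s) \<in> cells [k, k] \<and> (r', s) \<in> cells [k, k] \<and> r < r' \<longrightarrow> T (r, s) < T (r', s))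
     \<longleftrightarrow> (\<forall>s<k. T (0, s) < T (1, s))"
    by auto
  moreover have "(\<forall>r s s'. (r, s) \<in> cells [k, k] \<and> (r, s') \<in> cells [k, k] \<and> s < s' \<longrightarrow>
      T (r, s) \<le> T (r, s')) \<longleftrightarrow> (\<forall>r s s'. r < 2 \<and> s < s' \<and> s' < k \<longrightarrow> T (r, s) \<le> T (r, s'))"
    unfolding cells_two_rows using less_trans by blast
  ultimately show ?thesis
    unfolding semistandard_tableaux_def mem_Collect_eq by (simp only: cells_two_rows)
qed

text \<open>A weakly increasing row is recovered from its content as an increasing word, so a
  tableau is a pair of contents, coupled only by the column condition.\<close>

lemma bij_betw_tableaux_ballot_pairs:
  "bij_betw (\<lambda>T. (row_content n k T 0, row_content n k T 1))
     (semistandard_tableaux [k, k] n) (ballot_pairs n k)"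
proof (rule bij_betw_byWitness[where f' = "\<lambda>(f, g). \<lambda>(r, s)\<in>{(r, s). r < 2 \<and> s < k}.
      increasing_word (if r = 0 then f else g) s"], goal_cases)
  have content: "row_content n k T r \<in> compositions {1..n} k"
    and word: "\<And>s. s < k \<Longrightarrow> increasing_word (row_content n k T r) s = T (r, s)"
    if T: "T \<in> semistandard_tableaux [k, k] n" and r: "r < 2" for T r
  proof -
    have in_n: "T (r, s) \<in> {1..n}" if "s < k" for s
      using T r that unfolding semistandard_tableaux_two_rows by (auto simp: PiE_iff)
    have "sum (row_content n k T r) {1..n} = (\<Sum>i=1..n. card {s. s < k \<and> T (r, s) = i})"
      by (simp add: row_content_def)
    also have "\<dots> = card (\<Union>i\<in>{1..n}. {s. s < k \<and> T (r, s) = i})"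
      by (rule card_UN_disjoint[symmetric]) auto
    also have "(\<Union>i\<in>{1..n}. {s. s < k \<and> T (r, s) = i}) = {..<k}"
      using in_n by auto
    finally show "row_content n k T r \<in> compositions {1..n} k"
      by (simp add: compositions_def row_content_def)
    fix s assume s: "s < k"
    show "increasing_word (row_content n k T r) s = T (r, s)"
      unfolding row_content_def
      by (rule increasing_word_card[OF _ _ s])
        (use in_n T r in \<open>auto simp: semistandard_tableaux_two_rows\<close>)
  qed
  case 1
  show ?case
  proof
    fix T assume T: "T \<in> semistandard_tableaux [k, k] n"
    then have "T \<in> extensional {(r, s). r < 2 \<and> s < k}"
      by (auto simp: semistandard_tableaux_two_rows PiE_iff)
    then show "(case (row_content n k T 0, row_content n k T 1) of (f, g) \<Rightarrow>
      \<lambda>(r, s)\<in>{(r, s). r < 2 \<and> s < k}. increasing_word (if r = 0 then f else g) s) = T"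
      using word[OF T] by (auto simp: fun_eq_iff extensional_def less_2_cases_iff)
  qed
  case 3
  show ?case
  proof (rule image_subsetI)
    fix T assume T: "T \<in> semistandard_tableaux [k, k] n"
    then have "ballot_pair n (row_content n k T 0) (row_content n k T 1)"
      using word[OF T, of 0] word[OF T, of 1]
      by (subst increasing_word_less_iff_ballot[symmetric, OF content content])
        (auto simp: semistandard_tableaux_two_rows)
    then show "(row_content n k T 0, row_content n k T 1) \<in> ballot_pairs n k"
      using content[OF T] by (simp add: ballot_pairs_def)
  qed
next
  case 2
  show ?case
  proof
    fix p assume "p \<in> ballot_pairs n k"
    then obtain f g where p: "p = (f, g)"
      and fg: "f \<in> compositions {1..n} k" "g \<in> compositions {1..n} k"
      by (auto simp: ballot_pairs_def)
    have "(\<lambda>i\<in>{1..n}. card {s. s < k \<and> increasing_word h s = i}) = h"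
      if "h \<in> compositions {1..n} k" for h
      using card_increasing_word_eq[OF that] that
      by (auto simp: fun_eq_iff compositions_def PiE_iff extensional_def)
    with fg p show "(row_content n k (case p of (f, g) \<Rightarrow> \<lambda>(r, s)\<in>{(r, s). r < 2 \<and> s < k}.
        increasing_word (if r = 0 then f else g) s) 0,
      row_content n k (case p of (f, g) \<Rightarrow> \<lambda>(r, s)\<in>{(r, s). r < 2 \<and> s < k}.
        increasing_word (if r = 0 then f else g) s) 1) = p"
      by (simp add: row_content_def cong: conj_cong)
  qed
  case 4
  show ?case
  proof (rule image_subsetI)
    fix p assume "p \<in> ballot_pairs n k"
    then obtain f g where p: "p = (f, g)"
      and fg: "f \<in> compositions {1..n} k" "g \<in> compositions {1..n} k" "ballot_pair n f g"
      by (auto simp: ballot_pairs_def)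
    have mono: "increasing_word h s \<le> increasing_word h s'"
      if "h \<in> compositions {1..n} k" "s < s'" "s' < k" for h s s'
    proof -
      have "s' < sum h {1..increasing_word h s'}"
        using increasing_word_le_iff[OF that(1,3)] by blast
      then show ?thesis using increasing_word_le_iff[OF that(1), of s] that by simp
    qed
    show "(case p of (f, g) \<Rightarrow> \<lambda>(r, s)\<in>{(r, s). r < 2 \<and> s < k}.
        increasing_word (if r = 0 then f else g) s) \<in> semistandard_tableaux [k, k] n"
      unfolding semistandard_tableaux_two_rows p
      using fg mono increasing_word_in[OF fg(1)] increasing_word_in[OF fg(2)]
        increasing_word_less_iff_ballot[OF fg(1,2)]
      by (auto simp: less_2_cases_iff PiE_iff)
  qed
qed

lemma schur_two_rows: "schur [k, k] n x = ballot_sum n x k k"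
proof -
  have weight: "(\<Prod>i=1..n. x i ^ card {u \<in> cells [k, k]. T u = i}) =
     (\<Prod>i=1..n. x i ^ row_content n k T 0 i) * (\<Prod>i=1..n. x i ^ row_content n k T 1 i)" for T
    unfolding prod.distrib[symmetric]
  proof (intro prod.cong refl)
    fix i assume "i \<in> {1..n}"
    have cells: "{u \<in> cells [k, k]. T u = i} =
       Pair 0 ` {s. s < k \<and> T (0, s) = i} \<union> Pair 1 ` {s. s < k \<and> T (1, s) = i}"
      unfolding cells_two_rows less_2_cases_iff One_nat_def by fast
    have "card {u \<in> cells [k, k]. T u = i} = card {s. s < k \<and> T (0, s) = i} + card {s. s < k \<and> T (1, s) = i}"
      unfolding cells by (subst card_Un_disjoint) (auto simp: card_image inj_on_def)
    then show "x i ^ card {u \<in> cells [k, k]. T u = i} =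
      x i ^ row_content n k T 0 i * x i ^ row_content n k T 1 i"
      using \<open>i \<in> {1..n}\<close> by (simp add: row_content_def power_add)
  qed
  have "schur [k, k] n x = (\<Sum>(f, g)\<in>ballot_pairs n k.
     (\<Prod>i=1..n. x i ^ f i) * (\<Prod>i=1..n. x i ^ g i))"
    unfolding schur_def weight
    using sum.reindex_bij_betw[OF bij_betw_tableaux_ballot_pairs,
        of "\<lambda>(f, g). (\<Prod>i=1..n. x i ^ f i) * (\<Prod>i=1..n. x i ^ g i)"] by simp
  also have "\<dots> = (\<Sum>p\<in>compositions {1..n} k \<times> compositions {1..n} k.
      if ballot_pair n (fst p) (snd p)
      then (\<Prod>i=1..n. x i ^ fst p i) * (\<Prod>i=1..n. x i ^ snd p i) else 0)"
    unfolding ballot_pairs_def case_prod_unfold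
    by (subst sum.inter_filter[symmetric]) (simp_all add: finite_compositions)
  also have "\<dots> = ballot_sum n x k k"
    unfolding ballot_sum_def sum.cartesian_product case_prod_unfold ..
  finally show ?thesis .
qed

section \<open>Lifting edges to the integers; the group action\<close>

section \<open>Rotation of multidissections\<close>

text \<open>Any integer names a vertex, so rotation becomes addition and edges lift to the line,
  where they have a direction and a length.\<close>

definition vertex :: "nat \<Rightarrow> int \<Rightarrow> int" where
  "vertex n a = (a - 1) mod int n + 1"

definition edge :: "nat \<Rightarrow> int \<Rightarrow> int \<Rightarrow> int set" where
  "edge n a b = {vertex n a, vertex n b}"

lemma edge_commute: "edge n a b = edge n b a"
  by (auto simp: edge_def)

lemma rotate_vertex_vertex: "rotate_vertex n j (vertex n a) = vertex n (a + j)"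
proof -
  have "((a - 1) mod int n + j) mod int n = (a - 1 + j) mod int n"
    by (rule mod_add_left_eq)
  then show ?thesis by (simp add: rotate_vertex_def vertex_def algebra_simps)
qed

lemma rotate_edge: "rotate_vertex n j ` edge n a b = edge n (a + j) (b + j)"
  by (simp add: edge_def rotate_vertex_vertex)

lemma vertex_eq_iff: "vertex n a = vertex n b \<longleftrightarrow> a mod int n = b mod int n"
  by (simp add: vertex_def mod_eq_dvd_iff)

lemma vertex_in: "n > 0 \<Longrightarrow> vertex n a \<in> {1..int n}"
  using pos_mod_bound[of "int n" "a - 1"] pos_mod_sign[of "int n" "a - 1"]
  unfolding vertex_def atLeastAtMost_iff by linarith

lemma vertex_id: "a \<in> {1..int n} \<Longrightarrow> vertex n a = a"
  by (simp add: vertex_def)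

lemma vertex_add: "vertex n (a + int n * t) = vertex n a"
  by (simp add: vertex_eq_iff)

lemma vertex_shift: "vertex n (a - int n) = vertex n a"
  by (simp add: vertex_eq_iff)

lemma edge_cong:
  "a mod int n = a' mod int n \<Longrightarrow> b mod int n = b' mod int n \<Longrightarrow> edge n a b = edge n a' b'"
  by (simp add: edge_def vertex_eq_iff[symmetric])

lemma edge_in_polygon_edges:
  assumes "n > 0"
  shows "edge n a b \<in> polygon_edges n \<longleftrightarrow> a mod int n \<noteq> b mod int n"
  using vertex_in[OF assms, of a] vertex_in[OF assms, of b]
  by (auto simp: polygon_edges_def edge_def vertex_eq_iff[symmetric] card_insert_if)

lemma polygon_edgesE:
  assumes "e \<in> polygon_edges n"
  obtains a b where "1 \<le> a" "a < b" "b \<le> int n" "e = edge n a b"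
proof -
  obtain a b where ab: "e = {a, b}" "a \<noteq> b" "e \<subseteq> {1..int n}"
    using assms by (auto simp: polygon_edges_def card_2_iff)
  then have e: "e = edge n a b" "e = edge n b a" by (auto simp: edge_def vertex_id)
  have in_n: "1 \<le> a" "a \<le> int n" "1 \<le> b" "b \<le> int n" using ab by auto
  show ?thesis using that[OF in_n(1) _ in_n(4) e(1)] that[OF in_n(3) _ in_n(2) e(2)] ab(2) by linarith
qed

lemma edge_eq_iff:
  assumes "1 \<le> a" "a < b" "b \<le> int n" "1 \<le> c" "c < d" "d \<le> int n"
  shows "edge n a b = edge n c d \<longleftrightarrow> a = c \<and> b = d"
  using assms by (auto simp: edge_def vertex_id doubleton_eq_iff)

lemma finite_polygon_edges: "finite (polygon_edges n)"
  by (rule finite_subset[of _ "Pow {1..int n}"]) (auto simp: polygon_edges_def)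

lemma crossing_edge_iff:
  assumes "1 \<le> a" "a < b" "b \<le> int n" "1 \<le> c" "c < d" "d \<le> int n"
  shows "crossing (edge n a b) (edge n c d) \<longleftrightarrow> a < c \<and> c < b \<and> b < d \<or> c < a \<and> a < d \<and> d < b"
  using assms unfolding crossing_def edge_def
  by (simp add: vertex_id doubleton_eq_iff) (smt (verit))

text \<open>Full turns bring \<open>a\<close> into \<open>{1..n}\<close>; the cases then record
  which of the later end points have passed \<open>n\<close> and must be reduced once more.\<close>

lemma crossing_if_interleaved:
  assumes n: "n > 0" and o: "a < c" "c < b" "b < d" "d < a + int n"
  shows "crossing (edge n a b) (edge n c d)"
proof -
  define t where "t = (a - 1) div int n"
  have at: "vertex n a = a - int n * t"
    unfolding vertex_def t_def minus_mult_div_eq_mod[symmetric] by simp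
  define a' b' c' d' where "a' = a - int n * t" "b' = b - int n * t"
    "c' = c - int n * t" "d' = d - int n * t"
  note defs = this
  have a': "1 \<le> a'" "a' \<le> int n" using vertex_in[OF n, of a] at defs(1) by auto
  have o': "a' < c'" "c' < b'" "b' < d'" "d' < a' + int n" using o defs by auto
  have e: "edge n a b = edge n a' b'" "edge n c d = edge n c' d'"
    using vertex_add[of n _ "- t"] unfolding defs edge_def by simp_all
  have sh: "edge n x (y - int n) = edge n x y" "edge n (x - int n) y = edge n x y" for x y
    by (simp_all add: edge_def vertex_shift)
  consider "d' \<le> int n" | "b' \<le> int n" "int n < d'" | "c' \<le> int n" "int n < b'" | "int n < c'"
    by linarith
  then show ?thesis
  proof cases
    case 1
    then show ?thesis unfolding e using a' o' by (subst crossing_edge_iff) auto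
  next
    case 2
    have "crossing (edge n a' b') (edge n (d' - int n) c')"
      using 2 a' o' by (subst crossing_edge_iff) auto
    then show ?thesis unfolding e by (simp add: sh edge_commute[of n d'])
  next
    case 3
    have "crossing (edge n (b' - int n) a') (edge n (d' - int n) c')"
      using 3 a' o' by (subst crossing_edge_iff) auto
    then show ?thesis unfolding e by (simp add: sh edge_commute[of n d'] edge_commute[of n b'])
  next
    case 4
    have "crossing (edge n (b' - int n) a') (edge n (c' - int n) (d' - int n))"
      using 4 a' o' by (subst crossing_edge_iff) auto
    then show ?thesis unfolding e by (simp add: sh edge_commute[of n b'])
  qed
qed

lemma interleaved_if_crossing:
  assumes "e \<in> polygon_edges n" "e' \<in> polygon_edges n" "crossing e e'"
  obtains a b c d where "a < c" "c < b" "b < d" "d < a + int n" "e = edge n a b" "e' = edge n c d"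
proof -
  obtain a b where ab: "1 \<le> a" "a < b" "b \<le> int n" "e = edge n a b"
    using assms polygon_edgesE by metis
  obtain c d where cd: "1 \<le> c" "c < d" "d \<le> int n" "e' = edge n c d"
    using assms polygon_edgesE by metis
  have "a < c \<and> c < b \<and> b < d \<or> c < a \<and> a < d \<and> d < b"
    using crossing_edge_iff[OF ab(1-3) cd(1-3)] assms(3) ab(4) cd(4) by simp
  then show ?thesis
  proof
    assume "a < c \<and> c < b \<and> b < d"
    then show ?thesis using that[of a c b d] ab cd by auto
  next
    assume "c < a \<and> a < d \<and> d < b"
    \<comment> \<open>Seen from \<open>a\<close> the cyclic order is \<open>a\<close>,
      \<open>d\<close>, \<open>b\<close>, \<open>c + n\<close>, so \<open>e'\<close> is read
      backwards after moving \<open>c\<close> by one turn.\<close>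
    moreover have "e' = edge n d (c + int n)"
      using cd(4) edge_commute[of n d "c + int n"] vertex_add[of n c 1] by (simp add: edge_def)
    ultimately show ?thesis using that[of a d b "c + int n"] ab cd by auto
  qed
qed

text \<open>Inequalities between lifts are invariant under translation, unlike the order on
  \<open>{1..n}\<close>; this is the form of noncrossing that suits rotations.\<close>

lemma A_multidissections_iff:
  assumes n: "n > 0"
  shows "f \<in> A_multidissections n k \<longleftrightarrow> f \<in> polygon_edges n \<rightarrow>\<^sub>E UNIV \<and>
     (\<forall>a b c d. a < c \<and> c < b \<and> b < d \<and> d < a + int n \<longrightarrow>
        f (edge n a b) = 0 \<or> f (edge n c d) = 0) \<and>
     sum f (polygon_edges n) = k"
proof -
  have poly: "edge n a b \<in> polygon_edges n" if "a < b" "b < a + int n" for a b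
    unfolding edge_in_polygon_edges[OF n] mod_eq_dvd_iff
    using that zdvd_not_zless[of "b - a" "int n"] by (simp add: dvd_diff_commute)
  have "(\<forall>e\<in>polygon_edges n. \<forall>e'\<in>polygon_edges n. crossing e e' \<longrightarrow> f e = 0 \<or> f e' = 0) \<longleftrightarrow>
    (\<forall>a b c d. a < c \<and> c < b \<and> b < d \<and> d < a + int n \<longrightarrow>
        f (edge n a b) = 0 \<or> f (edge n c d) = 0)" (is "?L \<longleftrightarrow> ?R")
  proof
    assume ?L
    then show ?R using crossing_if_interleaved[OF n] poly by simp
  next
    assume ?R
    then show ?L using interleaved_if_crossing by metis
  qed
  then show ?thesis by (simp add: A_multidissections_def)
qed

text \<open>\<open>rotation_action\<close> without the outer restriction, hence independent of
  \<open>k\<close> and easy to compose.\<close>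

definition rotated :: "nat \<Rightarrow> int \<Rightarrow> (int set \<Rightarrow> nat) \<Rightarrow> int set \<Rightarrow> nat" where
  "rotated n j f = (\<lambda>e\<in>polygon_edges n. f (rotate_vertex n (- j) ` e))"

lemma rotated_edge:
  assumes "n > 0" "a mod int n \<noteq> b mod int n"
  shows "rotated n j f (edge n a b) = f (edge n (a - j) (b - j))"
  using assms by (simp add: rotated_def edge_in_polygon_edges rotate_edge)

lemma edge_functions_eqI:
  assumes "n > 0" "f \<in> extensional (polygon_edges n)" "g \<in> extensional (polygon_edges n)"
    and "\<And>a b. a mod int n \<noteq> b mod int n \<Longrightarrow> f (edge n a b) = g (edge n a b)"
  shows "f = g"
proof (rule extensionalityI[OF assms(2,3)])
  fix e assume e: "e \<in> polygon_edges n"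
  then obtain a b where "e = edge n a b" by (elim polygon_edgesE)
  then show "f e = g e" using e assms by (simp add: edge_in_polygon_edges)
qed

lemma mod_diff_cancel: "(a - j) mod m = (b - j) mod m \<longleftrightarrow> a mod m = b mod (m::int)"
  by (simp add: mod_eq_dvd_iff)

lemma rotated_rotated:
  assumes "n > 0" shows "rotated n i (rotated n j f) = rotated n (i + j) f"
proof (rule edge_functions_eqI[OF assms])
  fix a b assume "a mod int n \<noteq> b mod int n"
  then show "rotated n i (rotated n j f) (edge n a b) = rotated n (i + j) f (edge n a b)"
    using assms by (simp add: rotated_edge mod_diff_cancel diff_diff_eq)
qed (auto simp: rotated_def)

lemma rotated_0:
  assumes "n > 0" "f \<in> extensional (polygon_edges n)" shows "rotated n 0 f = f"
proof (rule edge_functions_eqI[OF assms(1)])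
  fix a b assume "a mod int n \<noteq> b mod int n"
  then show "rotated n 0 f (edge n a b) = f (edge n a b)"
    using rotated_edge[of n a b 0 f] assms by simp
qed (use assms in \<open>auto simp: rotated_def\<close>)

lemma rotated_mod: "rotated n (j mod int n) f = rotated n j f"
proof -
  have "rotate_vertex n (- (j mod int n)) i = rotate_vertex n (- j) i" for i
    by (simp add: rotate_vertex_def mod_diff_right_eq)
  then show ?thesis by (simp add: rotated_def)
qed

lemma rotated_in:
  assumes n: "n > 0" and f: "f \<in> A_multidissections n k"
  shows "rotated n j f \<in> A_multidissections n k"
  unfolding A_multidissections_iff[OF n]
proof (intro conjI allI impI)
  fix a b c d assume o: "a < c \<and> c < b \<and> b < d \<and> d < a + int n"
  then have "f (edge n (a - j) (b - j)) = 0 \<or> f (edge n (c - j) (d - j)) = 0"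
    using f unfolding A_multidissections_iff[OF n] by auto
  moreover have "a mod int n \<noteq> b mod int n" "c mod int n \<noteq> d mod int n"
    using o zdvd_not_zless[of "b - a" "int n"] zdvd_not_zless[of "d - c" "int n"]
    unfolding mod_eq_dvd_iff by (auto simp: dvd_diff_commute)
  ultimately show "rotated n j f (edge n a b) = 0 \<or> rotated n j f (edge n c d) = 0"
    using n by (simp add: rotated_edge)
next
  have inv: "rotate_vertex n i ` rotate_vertex n (- i) ` e = e \<and>
      rotate_vertex n i ` e \<in> polygon_edges n" if "e \<in> polygon_edges n" for i e
  proof -
    from that obtain a b where ab: "e = edge n a b" by (elim polygon_edgesE)
    then have "a mod int n \<noteq> b mod int n" using that n by (simp add: edge_in_polygon_edges)
    then have "(a + i) mod int n \<noteq> (b + i) mod int n" using mod_diff_cancel[of a "- i"] by simp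
    then show ?thesis using n by (simp add: ab rotate_edge edge_in_polygon_edges)
  qed
  have "sum (rotated n j f) (polygon_edges n) = (\<Sum>e\<in>polygon_edges n. f (rotate_vertex n (- j) ` e))"
    by (simp add: rotated_def)
  also have "\<dots> = sum f (polygon_edges n)"
    by (rule sum.reindex_bij_witness[where i = "image (rotate_vertex n j)"
          and j = "image (rotate_vertex n (- j))"])
      (use inv[of _ j] inv[of _ "- j"] in auto)
  finally show "sum (rotated n j f) (polygon_edges n) = k"
    using f by (simp add: A_multidissections_def)
qed (auto simp: rotated_def)

lemma extensional_A_multidissections:
  "f \<in> A_multidissections n k \<Longrightarrow> f \<in> extensional (polygon_edges n)"
  by (auto simp: A_multidissections_def PiE_iff)

lemma rotation_action_eq: "rotation_action n k j = (\<lambda>f\<in>A_multidissections n k. rotated n j f)"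
  by (simp add: rotation_action_def rotated_def)

lemma rotation_action_Bij:
  assumes n: "n > 0"
  shows "rotation_action n k j \<in> Bij (A_multidissections n k)"
proof -
  have "bij_betw (rotated n j) (A_multidissections n k) (A_multidissections n k)"
    by (rule bij_betw_byWitness[where f' = "rotated n (- j)"])
      (use n in \<open>auto simp: rotated_rotated rotated_in rotated_0 extensional_A_multidissections\<close>)
  then have "bij_betw (rotation_action n k j) (A_multidissections n k) (A_multidissections n k)"
    unfolding rotation_action_eq by (subst bij_betw_cong[where g = "rotated n j"]) auto
  then show ?thesis by (simp add: Bij_def rotation_action_eq)
qed

lemma group_action_rotation:
  assumes n: "n > 0"
  shows "group_action (integer_mod_group n) (A_multidissections n k) (rotation_action n k)"
proof (intro group_action.intro group_hom.intro group_hom_axioms.intro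
    group_integer_mod_group group_BijGroup homI)
  fix i j
  show "rotation_action n k i \<in> carrier (BijGroup (A_multidissections n k))"
    using rotation_action_Bij[OF n] by (simp add: BijGroup_def)
  show "rotation_action n k (i \<otimes>\<^bsub>integer_mod_group n\<^esub> j) =
    rotation_action n k i \<otimes>\<^bsub>BijGroup (A_multidissections n k)\<^esub> rotation_action n k j"
    using rotation_action_Bij[OF n]
    by (auto simp: BijGroup_def compose_def rotation_action_eq rotated_mod rotated_rotated[OF n]
        rotated_in[OF n] fun_eq_iff restrict_def)
qed

lemma finite_A_multidissections: "finite (A_multidissections n k)"
proof (rule finite_subset)
  show "A_multidissections n k \<subseteq> polygon_edges n \<rightarrow>\<^sub>E {..k}"
  proof
    fix f assume "f \<in> A_multidissections n k"
    then have "f \<in> extensional (polygon_edges n)" "sum f (polygon_edges n) = k"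
      by (auto simp: A_multidissections_def PiE_iff)
    then show "f \<in> polygon_edges n \<rightarrow>\<^sub>E {..k}"
      using member_le_sum[of _ "polygon_edges n" f] by (auto simp: PiE_iff finite_polygon_edges)
  qed
qed (simp add: finite_PiE finite_polygon_edges)

lemma generate_integer_mod_group:
  assumes n: "n \<ge> 2"
  shows "generate (integer_mod_group n) {1} = carrier (integer_mod_group n)"
proof
  show "generate (integer_mod_group n) {1} \<subseteq> carrier (integer_mod_group n)"
    using n by (intro group.generate_incl) auto
  have "int j \<in> generate (integer_mod_group n) {1}" if "j < n" for j
    using that
  proof (induction j)
    case 0
    then show ?case using generate.one[of "integer_mod_group n" "{1}"] by simp
  next
    case (Suc j)
    then have "int j \<otimes>\<^bsub>integer_mod_group n\<^esub> 1 \<in> generate (integer_mod_group n) {1}"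
      by (intro generate.eng) (auto intro: generate.incl)
    then show ?case using Suc.prems by (simp add: add.commute)
  qed
  then show "carrier (integer_mod_group n) \<subseteq> generate (integer_mod_group n) {1}"
    using n by (auto simp: carrier_integer_mod_group) (metis nat_less_iff nat_0_le)
qed

lemma ord_integer_mod_group:
  assumes n: "n \<ge> 2"
  shows "group.ord (integer_mod_group n) 1 = n"
proof -
  have "(1::int) \<in> carrier (integer_mod_group n)" using n by simp
  from group.pow_eq_id[OF group_integer_mod_group this]
  have "group.ord (integer_mod_group n) 1 dvd k \<longleftrightarrow> n dvd k" for k
    by (simp add: mod_eq_0_iff_dvd) 
  then show ?thesis by (meson dvd_antisym dvd_refl)
qed

lemma invariants_rotation:
  assumes n: "n \<ge> 2"
  shows "invariants (A_multidissections n k) (rotation_action n k) (1 [^]\<^bsub>integer_mod_group n\<^esub> d) =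
    {f \<in> A_multidissections n k. \<forall>a b. f (edge n (a + int d) (b + int d)) = f (edge n a b)}"
proof -
  have "rotated n (int d) f = f \<longleftrightarrow> (\<forall>a b. f (edge n (a + int d) (b + int d)) = f (edge n a b))"
    if f: "f \<in> A_multidissections n k" for f
  proof
    assume *: "rotated n (int d) f = f"
    show "\<forall>a b. f (edge n (a + int d) (b + int d)) = f (edge n a b)"
    proof (intro allI)
      fix a b
      have iff: "(a + int d) mod int n = (b + int d) mod int n \<longleftrightarrow> a mod int n = b mod int n"
        using mod_diff_cancel[of a "- int d"] by simp
      show "f (edge n (a + int d) (b + int d)) = f (edge n a b)"
      proof (cases "a mod int n = b mod int n")
        \<comment> \<open>A degenerate pair gives no edge: both values are the default of an
          extensional function, so quantifying over all \<open>a\<close> and \<open>b\<close> is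
          harmless.\<close>
        case True
        then show ?thesis
          using extensional_arb[OF extensional_A_multidissections[OF f]] n iff
          by (simp add: edge_in_polygon_edges)
      next
        case False
        then show ?thesis
          using rotated_edge[of n "a + int d" "b + int d" "int d" f] n iff * by simp
      qed
    qed
  next
    assume *: "\<forall>a b. f (edge n (a + int d) (b + int d)) = f (edge n a b)"
    show "rotated n (int d) f = f"
    proof (rule edge_functions_eqI)
      fix a b assume "a mod int n \<noteq> b mod int n"
      then show "rotated n (int d) f (edge n a b) = f (edge n a b)"
        using n *[rule_format, of "a - int d" "b - int d"] by (simp add: rotated_edge)
    qed (use n extensional_A_multidissections[OF f] in \<open>auto simp: rotated_def\<close>)
  qed
  then show ?thesis
    by (auto simp: invariants_def rotation_action_eq rotated_mod)
qed

section \<open>All dissections: chords on a line and ballot pairs\<close>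

section \<open>The number of multidissections\<close>

definition chords :: "nat \<Rightarrow> (nat \<times> nat) set" where
  "chords n = {(i, j). 1 \<le> i \<and> i < j \<and> j \<le> n}"

text \<open>One of the two cases of \<open>crossing\<close>, in which \<open>p\<close> opens first;
  the asymmetry fixes the roles in the uncrossing move.\<close>

definition chords_cross :: "nat \<times> nat \<Rightarrow> nat \<times> nat \<Rightarrow> bool" where
  "chords_cross p q \<longleftrightarrow> fst p < fst q \<and> fst q < snd p \<and> snd p < snd q"

text \<open>Since \<open>i y + k x < i x + k y\<close> for \<open>i < k\<close> and \<open>x < y\<close>, the product of the end points
  serves as the cost.\<close>

lemma uncrossing_chords:
  "uncrossing {1..n} {1..n} (chords n) chords_cross (\<lambda>(i, j). j - i) (\<lambda>(i, j). i * j)"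
proof
  fix i x k y :: nat
  assume "(i, x) \<in> chords n" "(k, y) \<in> chords n" "chords_cross (i, x) (k, y)"
  then have *: "i < k" "k < x" "x < y" "1 \<le> i" "y \<le> n" by (auto simp: chords_def chords_cross_def)
  then obtain d e where "k = i + d" "d > 0" "y = x + e" "e > 0"
    by (metis less_imp_add_positive)
  then have "i * y + k * x < i * x + k * y" by (simp add: algebra_simps)
  with * show "(i, y) \<in> chords n \<and> (k, x) \<in> chords n \<and>
    (case (i, y) of (i, j) \<Rightarrow> i * j) + (case (k, x) of (i, j) \<Rightarrow> i * j) <
    (case (i, x) of (i, j) \<Rightarrow> i * j) + (case (k, y) of (i, j) \<Rightarrow> i * j)"
    by (auto simp: chords_def)
qed (auto simp: chords_def chords_cross_def)

text \<open>Every arc that closes by time \<open>t\<close> has opened strictly before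
  \<open>t\<close>, so it is already counted among the earlier openings.\<close>

lemma margins_chords_in_ballot_pairs:
  assumes g: "\<And>p. p \<notin> chords n \<Longrightarrow> g p = (0::nat)" and k: "sum g (chords n) = k"
  shows "(\<lambda>i\<in>{1..n}. \<Sum>x\<in>{1..n}. g (i, x), \<lambda>x\<in>{1..n}. \<Sum>i\<in>{1..n}. g (i, x)) \<in> ballot_pairs n k"
proof -
  have S: "chords n \<subseteq> {1..n} \<times> {1..n}" by (auto simp: chords_def)
  have 1: "(\<Sum>i=1..n. \<Sum>x=1..n. g (i, x)) = k"
    using sum_nested_eq[of "{1..n}" "{1..n}" "chords n" g] S g k by simp
  have 2: "(\<Sum>x=1..n. \<Sum>i=1..n. g (i, x)) = k"
    using 1 by (subst sum.swap)
  have "(\<Sum>x=1..t. \<Sum>i=1..n. g (i, x)) \<le> (\<Sum>i=1..<t. \<Sum>x=1..n. g (i, x))" if t: "t \<in> {1..n}" for t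
  proof -
    have "(\<Sum>x=1..t. \<Sum>i=1..n. g (i, x)) = (\<Sum>x=1..t. \<Sum>i=1..<t. g (i, x))"
      by (intro sum.cong refl sum.mono_neutral_right) (use t g in \<open>auto simp: chords_def\<close>)
    also have "\<dots> = (\<Sum>i=1..<t. \<Sum>x=1..t. g (i, x))" by (rule sum.swap)
    also have "\<dots> \<le> (\<Sum>i=1..<t. \<Sum>x=1..n. g (i, x))"
      by (intro sum_mono sum_mono2) (use t in auto)
    finally show ?thesis .
  qed
  then have "ballot_pair n (\<lambda>i\<in>{1..n}. \<Sum>x\<in>{1..n}. g (i, x)) (\<lambda>x\<in>{1..n}. \<Sum>i\<in>{1..n}. g (i, x))"
    unfolding ballot_pair_def by (auto simp: sum_restrict)
  with 1 2 show ?thesis by (simp add: ballot_pairs_def compositions_def)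
qed

text \<open>The \<open>s\<close>-th opening is paired with the \<open>s\<close>-th closing, which
  comes later by the ballot condition. The resulting arcs may cross; uncrossing repairs this without
  changing the margins.\<close>

lemma ballot_pair_chords:
  assumes fg: "(f, g) \<in> ballot_pairs n k"
  obtains h where "\<forall>p. p \<notin> chords n \<longrightarrow> h p = (0::nat)"
    "(\<lambda>i\<in>{1..n}. \<Sum>x\<in>{1..n}. h (i, x)) = f" "(\<lambda>x\<in>{1..n}. \<Sum>i\<in>{1..n}. h (i, x)) = g"
proof -
  from fg have f: "f \<in> compositions {1..n} k" and g: "g \<in> compositions {1..n} k"
    and b: "ballot_pair n f g" by (auto simp: ballot_pairs_def)
  define u where "u = increasing_word f"
  define v where "v = increasing_word g"
  have uv: "u s \<in> {1..n}" "v s \<in> {1..n}" "u s < v s" if "s < k" for s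
    using increasing_word_in[OF f that] increasing_word_in[OF g that]
      increasing_word_less_iff_ballot[OF f g] b that by (auto simp: u_def v_def)
  define h where "h = (\<lambda>(i, x). card {s. s < k \<and> u s = i \<and> v s = x})"
  have "h p = 0" if "p \<notin> chords n" for p
  proof -
    have "{s. s < k \<and> u s = fst p \<and> v s = snd p} = {}"
      using that uv by (cases p) (fastforce simp: chords_def)
    then show ?thesis by (simp add: h_def case_prod_unfold)
  qed
  moreover have "(\<lambda>i\<in>{1..n}. \<Sum>x\<in>{1..n}. h (i, x)) = f"
  proof (rule extensionalityI[of _ "{1..n}"])
    fix i assume i: "i \<in> {1..n}"
    have "(\<Sum>x\<in>{1..n}. h (i, x)) = card {s. s < k \<and> u s = i}"
      unfolding h_def prod.case by (rule sum_card_fibres) (use uv in auto)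
    also have "\<dots> = f i" using card_increasing_word_eq[OF f i] by (simp add: u_def)
    finally show "(\<lambda>i\<in>{1..n}. \<Sum>x\<in>{1..n}. h (i, x)) i = f i" using i by simp
  qed (use f in \<open>auto simp: compositions_def PiE_iff\<close>)
  moreover have "(\<lambda>x\<in>{1..n}. \<Sum>i\<in>{1..n}. h (i, x)) = g"
  proof (rule extensionalityI[of _ "{1..n}"])
    fix x assume x: "x \<in> {1..n}"
    have "(\<Sum>i\<in>{1..n}. h (i, x)) = (\<Sum>i\<in>{1..n}. card {s. s < k \<and> v s = x \<and> u s = i})"
      by (simp add: h_def conj_commute)
    also have "\<dots> = card {s. s < k \<and> v s = x}"
      by (rule sum_card_fibres) (use uv in auto)
    also have "\<dots> = g x" using card_increasing_word_eq[OF g x] by (simp add: v_def)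
    finally show "(\<lambda>x\<in>{1..n}. \<Sum>i\<in>{1..n}. h (i, x)) x = g x" using x by simp
  qed (use g in \<open>auto simp: compositions_def PiE_iff\<close>)
  ultimately show ?thesis using that[of h] by blast
qed

lemma edge_of_nat:
  assumes "(i, j) \<in> chords n"
  shows "edge n (int i) (int j) = {int i, int j}"
  using assms by (auto simp: chords_def edge_def vertex_id)

lemma bij_betw_chords_edges:
  "bij_betw (\<lambda>(i, j). edge n (int i) (int j)) (chords n) (polygon_edges n)"
proof (rule bij_betw_imageI)
  show "inj_on (\<lambda>(i, j). edge n (int i) (int j)) (chords n)"
    by (rule inj_onI) (auto simp: chords_def edge_eq_iff)
  show "(\<lambda>(i, j). edge n (int i) (int j)) ` chords n = polygon_edges n"
  proof (intro equalityI subsetI)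
    fix e assume "e \<in> polygon_edges n"
    then obtain a b where "1 \<le> a" "a < b" "b \<le> int n" "e = edge n a b" by (elim polygon_edgesE)
    then show "e \<in> (\<lambda>(i, j). edge n (int i) (int j)) ` chords n"
      by (intro image_eqI[of _ _ "(nat a, nat b)"]) (auto simp: chords_def)
  qed (use edge_of_nat[of _ _ n] in \<open>auto simp: polygon_edges_def chords_def\<close>)
qed

text \<open>Each edge opens at its smaller and closes at its larger end; the dissection is then a
  noncrossing array, and its margins range over exactly the ballot pairs.\<close>

lemma card_A_multidissections:
  "card (A_multidissections n k) = card (ballot_pairs n k)"
proof -
  interpret uncrossing "{1..n}" "{1..n}" "chords n" chords_cross "\<lambda>(i, j). j - i" "\<lambda>(i, j). i * j"
    by (rule uncrossing_chords)
  define to_edge :: "nat \<times> nat \<Rightarrow> int set" where "to_edge = (\<lambda>(i, j). edge n (int i) (int j))"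
  define X where "X = {g \<in> noncrossing. sum g (chords n) = k}"
  define \<phi> where "\<phi> f p = (if p \<in> chords n then f (to_edge p) else 0)" for f :: "int set \<Rightarrow> nat" and p
  have bij: "bij_betw to_edge (chords n) (polygon_edges n)"
    unfolding to_edge_def by (rule bij_betw_chords_edges)
  have to_edgeE: "\<exists>p\<in>chords n. e = to_edge p" if "e \<in> polygon_edges n" for e
  proof -
    have "e \<in> to_edge ` chords n" using bij_betw_imp_surj_on[OF bij] that by (simp only:)
    then show ?thesis by (rule imageE) (rule bexI)
  qed
  have cr: "crossing (to_edge p) (to_edge q) \<longleftrightarrow> chords_cross p q \<or> chords_cross q p"
    if "p \<in> chords n" "q \<in> chords n" for p q
  proof -
    obtain i j where p: "p = (i, j)" by (cases p)
    obtain i' j' where q: "q = (i', j')" by (cases q)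
    have "1 \<le> int i" "int i < int j" "int j \<le> int n" "1 \<le> int i'" "int i' < int j'" "int j' \<le> int n"
      using that unfolding chords_def p q by auto
    from crossing_edge_iff[OF this] show ?thesis
      by (simp add: p q to_edge_def chords_cross_def)
  qed
  have "bij_betw \<phi> (A_multidissections n k) X"
  proof (rule bij_betw_imageI)
    show "inj_on \<phi> (A_multidissections n k)"
    proof (rule inj_onI)
      fix f f' assume f: "f \<in> A_multidissections n k" "f' \<in> A_multidissections n k" and eq: "\<phi> f = \<phi> f'"
      show "f = f'"
      proof (rule extensionalityI[OF f[THEN extensional_A_multidissections]])
        fix e assume "e \<in> polygon_edges n"
        then obtain p where "p \<in> chords n" "e = to_edge p" using to_edgeE by blast
        then show "f e = f' e" using fun_cong[OF eq, of p] by (simp add: \<phi>_def)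
      qed
    qed
    show "\<phi> ` A_multidissections n k = X"
    proof (intro equalityI image_subsetI subsetI)
      fix f assume f: "f \<in> A_multidissections n k"
      have "sum (\<phi> f) (chords n) = (\<Sum>p\<in>chords n. f (to_edge p))"
        by (simp add: \<phi>_def)
      also have "\<dots> = k"
        using f sum.reindex_bij_betw[OF bij, of f] by (simp add: A_multidissections_def)
      finally have "sum (\<phi> f) (chords n) = k" .
      moreover have "\<phi> f p = 0 \<or> \<phi> f q = 0" if "chords_cross p q" for p q
      proof (cases "p \<in> chords n \<and> q \<in> chords n")
        case True
        then have "crossing (to_edge p) (to_edge q)" using cr that by simp
        moreover have "to_edge p \<in> polygon_edges n" "to_edge q \<in> polygon_edges n"
          using bij_betwE[OF bij] True by blast+
        moreover have "crossing e e' \<Longrightarrow> f e = 0 \<or> f e' = 0"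
          if "e \<in> polygon_edges n" "e' \<in> polygon_edges n" for e e'
          using f that by (simp add: A_multidissections_def)
        ultimately have "f (to_edge p) = 0 \<or> f (to_edge q) = 0" by metis
        then show ?thesis by (simp add: \<phi>_def)
      next
        case False
        then show ?thesis by (auto simp: \<phi>_def)
      qed
      ultimately show "\<phi> f \<in> X"
        unfolding X_def noncrossing_def arrays_def by (simp add: \<phi>_def)
    next
      fix g assume g: "g \<in> X"
      then have g0: "g p = 0" if "p \<notin> chords n" for p
        using that by (simp add: X_def noncrossing_def arrays_def del: split_paired_All)
      define f where "f = (\<lambda>e\<in>polygon_edges n. g (the_inv_into (chords n) to_edge e))"
      have fe: "f (to_edge p) = g p" if "p \<in> chords n" for p
      proof -
        have "to_edge p \<in> polygon_edges n" using bij_betwE[OF bij] that by blast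
        then show ?thesis
          using the_inv_into_f_f[OF bij_betw_imp_inj_on[OF bij] that] by (simp add: f_def)
      qed
      have "f \<in> A_multidissections n k"
        unfolding A_multidissections_def
      proof (intro CollectI conjI ballI impI)
        fix e e' assume e: "e \<in> polygon_edges n" "e' \<in> polygon_edges n" "crossing e e'"
        obtain p where p: "p \<in> chords n" "e = to_edge p" using to_edgeE[OF e(1)] by blast
        obtain q where q: "q \<in> chords n" "e' = to_edge q" using to_edgeE[OF e(2)] by blast
        note pq = p(1) q(1) p(2) q(2)
        have "chords_cross p q \<or> chords_cross q p" using cr[OF pq(1,2)] e(3) pq(3,4) by simp
        moreover have nc: "\<forall>p q. chords_cross p q \<longrightarrow> g p = 0 \<or> g q = 0"
          using g by (simp add: X_def noncrossing_def del: split_paired_All)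
        ultimately have "g p = 0 \<or> g q = 0"
          using nc[rule_format, of p q] nc[rule_format, of q p] by argo
        then show "f e = 0 \<or> f e' = 0" using fe[OF pq(1)] fe[OF pq(2)] by (simp add: pq(3,4))
      next
        have "sum f (polygon_edges n) = (\<Sum>p\<in>chords n. f (to_edge p))"
          using sum.reindex_bij_betw[OF bij, of f] by simp
        also have "\<dots> = k" using g fe by (simp add: X_def)
        finally show "sum f (polygon_edges n) = k" .
      qed (simp add: f_def)
      moreover have "\<phi> f = g" using fe g0 by (auto simp: \<phi>_def fun_eq_iff)
      ultimately show "g \<in> \<phi> ` A_multidissections n k" by blast
    qed
  qed
  moreover have "bij_betw margins X (ballot_pairs n k)"
  proof (rule bij_betw_imageI)
    show "inj_on margins X" using inj_on_margins by (rule inj_on_subset) (auto simp: X_def)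
    show "margins ` X = ballot_pairs n k"
    proof (intro equalityI image_subsetI subsetI)
      fix g assume "g \<in> X"
      then show "margins g \<in> ballot_pairs n k"
        unfolding margins_def
        by (intro margins_chords_in_ballot_pairs)
          (auto simp: X_def noncrossing_def arrays_def simp del: split_paired_All)
    next
      fix p assume p: "p \<in> ballot_pairs n k"
      obtain f g where fg: "p = (f, g)" by (cases p)
      obtain h where h: "\<forall>p. p \<notin> chords n \<longrightarrow> h p = (0::nat)"
        "(\<lambda>i\<in>{1..n}. \<Sum>x\<in>{1..n}. h (i, x)) = f" "(\<lambda>x\<in>{1..n}. \<Sum>i\<in>{1..n}. h (i, x)) = g"
        by (rule ballot_pair_chords[OF p[unfolded fg]])
      then have "margins h = p" unfolding margins_def fg by (simp only:)
      moreover have "h \<in> arrays" using h(1) by (simp add: arrays_def del: split_paired_All)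
      ultimately have "p \<in> margins ` noncrossing"
        using bij_betw_imp_surj_on[OF bij_betw_margins] by blast
      then obtain g' where g': "g' \<in> noncrossing" "margins g' = p" by blast
      \<comment> \<open>Uncrossing preserves the number of arcs because the total can be read off
        the row margins.\<close>
      have "sum g' (chords n) = (\<Sum>i=1..n. \<Sum>x=1..n. g' (i, x))"
        by (rule sum_nested_eq[symmetric])
          (use g' S_subset in \<open>auto simp: noncrossing_def arrays_def simp del: split_paired_All\<close>)
      also have "\<dots> = sum f {1..n}"
      proof -
        have "(\<lambda>i\<in>{1..n}. \<Sum>x\<in>{1..n}. g' (i, x)) = f"
          using g'(2) unfolding margins_def fg by (simp only: prod.inject)
        then show ?thesis using sum_restrict[OF subset_refl] by metis
      qed
      also have "\<dots> = k" using p by (simp add: fg ballot_pairs_def compositions_def)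
      finally show "p \<in> margins ` X" using g' by (auto simp: X_def)
    qed
  qed
  ultimately show ?thesis by (metis bij_betw_same_card)
qed

section \<open>Arcs modulo N as an instance of uncrossing\<close>

section \<open>Multidissections invariant under a rotation\<close>

text \<open>The shift by one makes the range \<open>{1..M}\<close>: from a point to itself the
  distance is a full turn \<open>M\<close>, not 0.\<close>

definition gap :: "int \<Rightarrow> int \<Rightarrow> int \<Rightarrow> int" where
  "gap M a b = (b - a - 1) mod M + 1"

lemma gap_bounds: "M > 0 \<Longrightarrow> 1 \<le> gap M a b" "M > 0 \<Longrightarrow> gap M a b \<le> M"
  using pos_mod_bound[of M "b - a - 1"] pos_mod_sign[of M "b - a - 1"] unfolding gap_def by linarith+

lemma gap_dvd: "M dvd b - a - gap M a b"
proof -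
  have "M dvd (b - a - 1) - (b - a - 1) mod M" by (rule dvd_minus_mod)
  then show ?thesis by (simp add: gap_def algebra_simps)
qed

lemma gap_eqI:
  assumes "1 \<le> g" "g \<le> M" "M dvd b - a - g"
  shows "gap M a b = g"
proof -
  have "(b - a - 1) mod M = (g - 1) mod M"
    unfolding mod_eq_dvd_iff using assms(3) by (simp add: algebra_simps)
  then show ?thesis using assms by (simp add: gap_def)
qed

lemma gap_cong: "M dvd a - a' \<Longrightarrow> M dvd b - b' \<Longrightarrow> gap M a b = gap M a' b'"
proof -
  assume "M dvd a - a'" "M dvd b - b'"
  then have "M dvd (b - b') - (a - a')" by (rule dvd_diff[rotated])
  moreover have "(b - b') - (a - a') = (b - a - 1) - (b' - a' - 1)" by simp
  ultimately have "(b - a - 1) mod M = (b' - a' - 1) mod M" unfolding mod_eq_dvd_iff by metis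
  then show ?thesis by (simp add: gap_def)
qed

text \<open>Arcs on the cyclic index set modulo \<open>N\<close>: the arc \<open>(i, Some j)\<close> runs from \<open>i\<close>
  to the next representative of \<open>j\<close>, and \<open>(i, None)\<close> never closes; the length \<open>2 N\<close>
  makes it reach beyond every closed arc that starts above \<open>i\<close>.\<close>

fun arc_length :: "nat \<Rightarrow> int \<times> int option \<Rightarrow> int" where
  "arc_length N (i, Some j) = gap (int N) i j"
| "arc_length N (i, None) = 2 * int N"

definition cyclic_arcs :: "nat \<Rightarrow> (int \<times> int option) set" where
  "cyclic_arcs N = {0..<int N} \<times> insert None (Some ` {0..<int N})"

text \<open>Some lift of \<open>q\<close> starts inside \<open>p\<close> and ends after it. An open
  \<open>p\<close> is excluded because it has no end for \<open>q\<close> to pass.\<close>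

definition arcs_cross :: "nat \<Rightarrow> int \<times> int option \<Rightarrow> int \<times> int option \<Rightarrow> bool" where
  "arcs_cross N p q \<longleftrightarrow> snd p \<noteq> None \<and> (\<exists>t. fst p < fst q + int N * t \<and>
     fst q + int N * t < fst p + arc_length N p \<and>
     fst p + arc_length N p < fst q + int N * t + arc_length N q)"

text \<open>The cost \<open>l (4 N - l)\<close> of an arc of length \<open>l\<close> is concave, for uncrossings that
  preserve the total length, and increasing, for those that wind once less around the circle.\<close>

lemma cost_mono:
  fixes x y M :: int
  assumes "x < y" "y \<le> 2 * M"
  shows "x * (4 * M - x) < y * (4 * M - y)"
proof -
  have "y * (4 * M - y) - x * (4 * M - x) = (y - x) * (4 * M - x - y)" by (simp add: algebra_simps)
  moreover have "0 < (y - x) * (4 * M - x - y)" using assms by (intro mult_pos_pos) auto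
  ultimately show ?thesis by linarith
qed

lemma uncrossed_cost:
  assumes N: "N > 0" and cr: "i < k'" "k' < i + a" "i + a < k' + b"
    and k': "k' = k + int N * t" and a: "a = arc_length N (i, Some j)" and b: "b = arc_length N (k, y)"
    and u: "u = arc_length N (k, Some j)" and v: "v = arc_length N (i, y)"
  shows "u * (4 * int N - u) + v * (4 * int N - v) < a * (4 * int N - a) + b * (4 * int N - b)"
proof -
  have M: "int N > 0" using N by simp
  have a_le: "a \<le> int N" using gap_bounds(2)[OF M] a by simp
  obtain ta where ta: "j - i - a = int N * ta" using gap_dvd[of "int N" j i] a by (auto elim: dvdE)
  \<comment> \<open>The arc from \<open>k'\<close> to the end of the first arc lies inside both arcs
    and is shorter than either.\<close>
  have u': "u = i + a - k'"
    unfolding u arc_length.simps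
  proof (rule gap_eqI)
    have "j - k - (i + a - k') = int N * (ta + t)" using ta k' by (simp add: algebra_simps)
    then show "int N dvd j - k - (i + a - k')" by simp
  qed (use cr a_le in auto)
  then have ua: "0 < u" "u < a" "u < b" using cr by auto
  show ?thesis
  proof (cases y)
    case None
    \<comment> \<open>The open arc stays open with the same formal length; only the closed one gets
      shorter.\<close>
    then have "v = b" using b v by simp
    moreover have "u * (4 * int N - u) < a * (4 * int N - a)"
      by (rule cost_mono) (use ua a_le M in auto)
    ultimately show ?thesis by simp
  next
    case (Some l)
    then have b_le: "b \<le> int N" and v_bounds: "1 \<le> v" "v \<le> int N"
      using gap_bounds[OF M] b v by auto
    obtain tb where tb: "l - k - b = int N * tb"
      using gap_dvd[of "int N" l k] b Some by (auto elim: dvdE)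
    \<comment> \<open>The distance from \<open>i\<close> to the end of the second arc. It may exceed
      one turn, and then \<open>v\<close> is shorter by \<open>N\<close>.\<close>
    have w: "a + b - u = k' + b - i" using u' by simp
    show ?thesis
    proof (cases "a + b - u \<le> int N")
      case True
      have ve: "v = a + b - u"
        unfolding v Some arc_length.simps
      proof (rule gap_eqI)
        have "l - i - (a + b - u) = int N * (tb - t)" using tb k' w by (simp add: algebra_simps)
        then show "int N dvd l - i - (a + b - u)" by simp
      qed (use True ua in auto)
      \<comment> \<open>Concavity: for a fixed total length, passing from \<open>a\<close>,
        \<open>b\<close> to the more unequal \<open>u\<close>, \<open>v\<close> lowers the
        cost.\<close>
      have "a * (4 * int N - a) + b * (4 * int N - b) - (u * (4 * int N - u) + v * (4 * int N - v))
        = 2 * ((a - u) * (b - u))" unfolding ve by (simp add: algebra_simps)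
      moreover have "0 < (a - u) * (b - u)" using ua by (intro mult_pos_pos) auto
      ultimately show ?thesis by linarith
    next
      case False
      have "v = a + b - u - int N"
        unfolding v Some arc_length.simps
      proof (rule gap_eqI)
        have "l - i - (a + b - u - int N) = int N * (tb - t + 1)"
          using tb k' w by (simp add: algebra_simps)
        then show "int N dvd l - i - (a + b - u - int N)" by simp
      qed (use False ua a_le b_le in auto)
      then have "v < a" using ua b_le by linarith
      then show ?thesis
        using cost_mono[of v a "int N"] cost_mono[of u b "int N"] ua a_le b_le M by linarith
    qed
  qed
qed

lemma arc_length_bounds:
  assumes "N > 0" shows "1 \<le> arc_length N p" "arc_length N p \<le> 2 * int N"
proof -
  obtain i x where p: "p = (i, x)" by (cases p)
  have "1 \<le> arc_length N p \<and> arc_length N p \<le> 2 * int N"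
  proof (cases x)
    case (Some j)
    then show ?thesis using gap_bounds[of "int N" i j] assms p by simp
  qed (use assms p in simp)
  then show "1 \<le> arc_length N p" "arc_length N p \<le> 2 * int N" by auto
qed

lemma residues_eq:
  "i \<in> {0..<int N} \<Longrightarrow> j \<in> {0..<int N} \<Longrightarrow> int N dvd i - j \<Longrightarrow> i = j"
  by (metis mod_eq_dvd_iff mod_pos_pos_trivial atLeastLessThan_iff)

lemma uncrossing_cyclic:
  assumes N: "N > 0"
  shows "uncrossing {0..<int N} (insert None (Some ` {0..<int N})) (cyclic_arcs N) (arcs_cross N)
    (\<lambda>p. nat (arc_length N p)) (\<lambda>p. nat (arc_length N p * (4 * int N - arc_length N p)))"
proof
  fix i x k y
  assume S: "(i, x) \<in> cyclic_arcs N" "(k, y) \<in> cyclic_arcs N" and cr: "arcs_cross N (i, x) (k, y)"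
  from cr obtain j t where x: "x = Some j" and t: "i < k + int N * t"
     "k + int N * t < i + arc_length N (i, x)" "i + arc_length N (i, x) < k + int N * t + arc_length N (k, y)"
    by (auto simp: arcs_cross_def)
  let ?c = "\<lambda>p. arc_length N p * (4 * int N - arc_length N p)"
  have "?c (k, x) + ?c (i, y) < ?c (i, x) + ?c (k, y)"
    using uncrossed_cost[OF N t[unfolded x] refl refl refl refl refl] by (simp add: x)
  moreover have c: "?c p \<ge> 0" for p
    using arc_length_bounds[OF N, of p] by (intro mult_nonneg_nonneg) auto
  ultimately have "nat (?c (i, y)) + nat (?c (k, x)) < nat (?c (i, x)) + nat (?c (k, y))"
    using c[of "(i, x)"] c[of "(k, y)"] c[of "(i, y)"] c[of "(k, x)"] by linarith
  then show "(i, y) \<in> cyclic_arcs N \<and> (k, x) \<in> cyclic_arcs N \<and>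
     nat (?c (i, y)) + nat (?c (k, x)) < nat (?c (i, x)) + nat (?c (k, y))"
    using S by (simp add: cyclic_arcs_def)
next
  fix i x k y
  assume S: "(i, x) \<in> cyclic_arcs N" "(i, y) \<in> cyclic_arcs N" "(k, x) \<in> cyclic_arcs N"
    and ne: "x \<noteq> y" "k \<noteq> i"
    and le: "nat (arc_length N (i, x)) \<le> nat (arc_length N (i, y))"
      "nat (arc_length N (i, x)) \<le> nat (arc_length N (k, x))"
  have M: "int N > 0" using N by simp
  have le': "arc_length N (i, x) \<le> arc_length N (i, y)" "arc_length N (i, x) \<le> arc_length N (k, x)"
    using le arc_length_bounds[OF N, of "(i, x)"] arc_length_bounds[OF N, of "(i, y)"]
      arc_length_bounds[OF N, of "(k, x)"] by linarith+
  \<comment> \<open>An open arc is longer than every closed one, so the shortest of the arcs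
    compared is closed.\<close>
  have "x \<noteq> None"
  proof
    assume x: "x = None"
    then obtain l where "y = Some l" using ne by (cases y) auto
    then show False using le' x gap_bounds(2)[OF M, of i l] M by simp
  qed
  then obtain j where x: "x = Some j" by auto
  define a where "a = gap (int N) i j"
  define b where "b = gap (int N) k j"
  have I: "i \<in> {0..<int N}" "k \<in> {0..<int N}" "j \<in> {0..<int N}"
    using S x by (auto simp: cyclic_arcs_def)
  obtain ta where ta: "j - i - a = int N * ta" using gap_dvd[of "int N" j i] by (auto simp: a_def elim: dvdE)
  obtain tb where tb: "j - k - b = int N * tb" using gap_dvd[of "int N" j k] by (auto simp: b_def elim: dvdE)
  have "a \<noteq> b"
  proof
    assume "a = b"
    then have "k - i = int N * (ta - tb)" using ta tb by (simp add: algebra_simps)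
    then have "k = i" by (intro residues_eq[of k N i] I) simp
    then show False using ne by simp
  qed
  then have "a < b" using le' by (simp add: x a_def b_def)
  have "a < arc_length N (i, y)"
  proof (cases y)
    case None
    then show ?thesis using gap_bounds(2)[OF M, of i j] M by (simp add: a_def)
  next
    case (Some l)
    obtain tl where tl: "l - i - gap (int N) i l = int N * tl"
      using gap_dvd[of "int N" l i] by (auto elim: dvdE)
    have "a \<noteq> gap (int N) i l"
    proof
      assume "a = gap (int N) i l"
      then have "j - l = int N * (ta - tl)" using ta tl by (simp add: algebra_simps)
      then have "j = l" using I S Some by (intro residues_eq[of j N l]) (auto simp: cyclic_arcs_def)
      then show False using ne x Some by simp
    qed
    then show ?thesis using le' Some x by (simp add: a_def)
  qed
  \<comment> \<open>This lift of \<open>i\<close> makes the two arcs to \<open>j\<close> end at the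
    same point: the shorter one starts inside the longer, and the arc to \<open>y\<close> runs on
    past their common end.\<close>
  moreover have "i + int N * (ta - tb) = k + b - a" using ta tb by (simp add: algebra_simps)
  ultimately show "arcs_cross N (k, x) (i, y)"
    unfolding arcs_cross_def using \<open>a < b\<close> gap_bounds(1)[OF M, of i j]
    by (auto simp: x b_def[symmetric] a_def[symmetric] intro!: exI[of _ "ta - tb"])
qed (auto simp: cyclic_arcs_def)

text \<open>The columns include \<open>None\<close> and carry no natural order, so the word is an
  arbitrary listing of the multiset; on a circle any pairing of letters gives arcs.\<close>

lemma ex_word:
  assumes "finite I" "f \<in> compositions I k"
  obtains u where "\<And>s. s < k \<Longrightarrow> u s \<in> I" "\<And>i. i \<in> I \<Longrightarrow> card {s. s < k \<and> u s = i} = f i"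
proof -
  obtain xs where xs: "mset xs = (\<Sum>i\<in>I. replicate_mset (f i) i)" using ex_mset by blast
  have set: "set xs \<subseteq> I"
    unfolding set_mset_mset[symmetric] xs using assms(1) by (auto simp: set_mset_sum split: if_splits)
  have count: "count_list xs i = f i" if "i \<in> I" for i
  proof -
    have "count_list xs i = count (mset xs) i" by (simp add: count_mset count_list_eq_length_filter)
    also have "\<dots> = f i" unfolding xs using that assms(1) by (simp add: count_sum)
    finally show ?thesis .
  qed
  have len: "length xs = k"
    using sum_count_set[OF set assms(1)] count assms(2) by (simp add: compositions_def)
  show ?thesis
  proof (rule that[of "\<lambda>s. xs ! s"])
    fix i assume i: "i \<in> I"
    have "card {s. s < k \<and> xs ! s = i} = length (filter (\<lambda>x. x = i) xs)"
      by (simp add: length_filter_conv_card len)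
    also have "filter (\<lambda>x. x = i) xs = filter ((=) i) xs" by (rule filter_cong) auto
    finally show "card {s. s < k \<and> xs ! s = i} = f i"
      using count[OF i] by (simp only: count_list_eq_length_filter)
  qed (use set len in auto)
qed

lemma arcs_crossI:
  assumes "x \<noteq> None" and o: "a < c" "c < a + arc_length N (a mod int N, x)"
    "a + arc_length N (a mod int N, x) < c + arc_length N (c mod int N, y)"
  shows "arcs_cross N (a mod int N, x) (c mod int N, y)"
proof -
  define t where "t = c div int N - a div int N"
  have "int N * (a div int N) = a - a mod int N" "int N * (c div int N) = c - c mod int N"
    by (simp_all add: minus_mod_eq_mult_div)
  moreover have "int N * t = int N * (c div int N) - int N * (a div int N)"
    by (simp add: t_def right_diff_distrib)
  ultimately have "c mod int N + int N * t = c - int N * (a div int N)"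
    "a mod int N = a - int N * (a div int N)"
    by linarith+
  then have "a mod int N < c mod int N + int N * t \<and>
     c mod int N + int N * t < a mod int N + arc_length N (a mod int N, x) \<and>
     a mod int N + arc_length N (a mod int N, x) < c mod int N + int N * t + arc_length N (c mod int N, y)"
    using o by linarith
  then show ?thesis using assms(1) unfolding arcs_cross_def fst_conv snd_conv by blast
qed

lemma gap_of_mod: "gap (int N) (a mod int N) (b mod int N) = gap (int N) a b"
  by (rule gap_cong) (simp_all add: mod_eq_dvd_iff[symmetric])

lemma gap_diff: "a < b \<Longrightarrow> b \<le> a + M \<Longrightarrow> gap M a b = b - a"
  by (rule gap_eqI) auto

lemma sum_residues:
  assumes "N > 0"
  shows "(\<Sum>a\<in>{c + 1..c + int N}. F (a mod int N)) = (\<Sum>j\<in>{0..<int N}. F j)"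
proof (rule sum.reindex_bij_witness[where i = "\<lambda>j. c + gap (int N) c j" and j = "\<lambda>a. a mod int N"])
  have M: "int N > 0" using assms by simp
  fix a assume a: "a \<in> {c + 1..c + int N}"
  have "gap (int N) c (a mod int N) = gap (int N) c a"
    by (rule gap_cong) (simp_all add: mod_eq_dvd_iff[symmetric])
  also have "\<dots> = a - c" by (rule gap_diff) (use a in auto)
  finally show "c + gap (int N) c (a mod int N) = a" by simp
  show "a mod int N \<in> {0..<int N}" using M by simp
next
  have M: "int N > 0" using assms by simp
  fix j assume j: "j \<in> {0..<int N}"
  have "int N dvd j - (c + gap (int N) c j)"
    using gap_dvd[of "int N" j c] by (simp add: algebra_simps)
  then have "j mod int N = (c + gap (int N) c j) mod int N" unfolding mod_eq_dvd_iff .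
  then show "(c + gap (int N) c j) mod int N = j" using j by simp
  show "c + gap (int N) c j \<in> {c + 1..c + int N}" using gap_bounds[OF M, of c j] by auto
qed simp

lemma sum_residues_repeated:
  assumes "N > 0"
  shows "(\<Sum>a\<in>{1..int (m * N)}. F (a mod int N)) = m * (\<Sum>j\<in>{0..<int N}. F j :: nat)"
proof (induction m)
  case (Suc m)
  have "{1..z + int N} = {1..z} \<union> {z + 1..z + int N}" if "0 \<le> z" for z
    using that by auto
  from this[of "int (m * N)"]
  have "{1..int (Suc m * N)} = {1..int (m * N)} \<union> {int (m * N) + 1..int (m * N) + int N}"
    by (simp add: algebra_simps)
  then have "(\<Sum>a\<in>{1..int (Suc m * N)}. F (a mod int N)) =
     (\<Sum>a\<in>{1..int (m * N)}. F (a mod int N)) + (\<Sum>a\<in>{int (m * N) + 1..int (m * N) + int N}. F (a mod int N))"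
    by (simp only:) (rule sum.union_disjoint, auto)
  then show ?case using Suc sum_residues[OF assms] by simp
qed simp

lemma bij_betw_edges:
  "bij_betw (\<lambda>(a, b). edge n a b) {(a, b). 1 \<le> a \<and> a < b \<and> b \<le> int n} (polygon_edges n)"
proof (rule bij_betw_imageI)
  show "inj_on (\<lambda>(a, b). edge n a b) {(a, b). 1 \<le> a \<and> a < b \<and> b \<le> int n}"
    by (rule inj_onI) (auto simp: edge_eq_iff)
  show "(\<lambda>(a, b). edge n a b) ` {(a, b). 1 \<le> a \<and> a < b \<and> b \<le> int n} = polygon_edges n"
  proof (intro equalityI subsetI)
    fix e assume "e \<in> polygon_edges n"
    then obtain a b where "1 \<le> a" "a < b" "b \<le> int n" "e = edge n a b" by (elim polygon_edgesE)
    then show "e \<in> (\<lambda>(a, b). edge n a b) ` {(a, b). 1 \<le> a \<and> a < b \<and> b \<le> int n}" by auto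
  next
    fix e assume "e \<in> (\<lambda>(a, b). edge n a b) ` {(a, b). 1 \<le> a \<and> a < b \<and> b \<le> int n}"
    then obtain a b where ab: "1 \<le> a" "a < b" "b \<le> int n" "e = edge n a b" by auto
    have "{a, b} \<in> polygon_edges n" using ab(1-3) by (auto simp: polygon_edges_def)
    moreover have "e = {a, b}" using ab by (simp add: edge_def vertex_id)
    ultimately show "e \<in> polygon_edges n" by simp
  qed
qed

text \<open>The two directions of an edge have lengths adding up to \<open>n\<close>, and
  \<open>2 \<le> m\<close> gives \<open>2 * N \<le> n\<close>; so both can be at most
  \<open>N\<close> only for a diameter with \<open>m = 2\<close>.\<close>

locale rotation_period =
  fixes m N n :: nat
  assumes m: "2 \<le> m" and N: "0 < N" and n: "n = m * N"
begin

sublocale uncrossing "{0..<int N}" "insert None (Some ` {0..<int N})" "cyclic_arcs N" "arcs_cross N"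
  "\<lambda>p. nat (arc_length N p)" "\<lambda>p. nat (arc_length N p * (4 * int N - arc_length N p))"
  by (rule uncrossing_cyclic[OF N])

abbreviation residues :: "int set" where
  "residues \<equiv> {0..<int N}"

section \<open>Counting noncrossing arrays modulo N\<close>

definition closed_sum :: "(int \<times> int option \<Rightarrow> nat) \<Rightarrow> nat" where
  "closed_sum g = (\<Sum>i\<in>residues. \<Sum>j\<in>residues. g (i, Some j))"

definition open_sum :: "(int \<times> int option \<Rightarrow> nat) \<Rightarrow> nat" where
  "open_sum g = (\<Sum>i\<in>residues. g (i, None))"

definition noncrossing_arrays :: "nat \<Rightarrow> nat \<Rightarrow> (int \<times> int option \<Rightarrow> nat) set" where
  "noncrossing_arrays p e = {g \<in> noncrossing. closed_sum g = p \<and> open_sum g = e}"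

lemma M_pos: "int N > 0"
  using N by simp

lemma n_pos: "n > 0"
  using n m N by simp

lemma n_ge: "2 * int N \<le> int n"
proof -
  have "2 * N \<le> n" using m by (simp add: n)
  then show ?thesis by linarith
qed

lemma n_eq_iff: "int n = 2 * int N \<longleftrightarrow> m = 2"
  using n N by auto

lemma n_ge3: "m \<noteq> 2 \<Longrightarrow> 3 * int N \<le> int n"
proof -
  assume "m \<noteq> 2"
  then have "3 * N \<le> n" using m by (simp add: n)
  then show ?thesis by linarith
qed

lemma N_dvd_n: "int N dvd int n"
  using n by simp

lemma mod_n_shift: "(a + int n) mod int N = a mod int N" "(a - int n) mod int N = a mod int N"
  unfolding mod_eq_dvd_iff using N_dvd_n by simp_all

lemma mod_n_eq: "a mod int n = b mod int n \<Longrightarrow> a mod int N = b mod int N"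
  using N_dvd_n by (metis mod_mod_cancel)

lemma sum_columns:
  "(\<Sum>x\<in>insert None (Some ` residues). h x) = h None + (\<Sum>j\<in>residues. h (Some j) :: nat)"
  by (subst sum.insert) (auto simp: sum.reindex)

text \<open>On a circle every opening can reach every closing, so margins are restricted only by
  their totals and the count is a product. The sum of column \<open>None\<close> is the constant
  \<open>e\<close>, which is why \<open>\<mu>\<close> omits it.\<close>

lemma card_noncrossing_arrays:
  "card (noncrossing_arrays p e) = card (compositions residues (p + e)) * card (compositions residues p)"
proof -
  let ?J = "insert None (Some ` residues)"
  define \<mu> where "\<mu> g = (\<lambda>i\<in>residues. \<Sum>x\<in>?J. g (i, x), \<lambda>j\<in>residues. \<Sum>i\<in>residues. g (i, Some j))"
    for g :: "int \<times> int option \<Rightarrow> nat"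
  have "bij_betw \<mu> (noncrossing_arrays p e) (compositions residues (p + e) \<times> compositions residues p)"
  proof (rule bij_betw_imageI)
    show "inj_on \<mu> (noncrossing_arrays p e)"
    proof (rule inj_onI)
      fix g g' assume g: "g \<in> noncrossing_arrays p e" "g' \<in> noncrossing_arrays p e" and eq: "\<mu> g = \<mu> g'"
      from eq have "(\<lambda>i\<in>residues. \<Sum>x\<in>?J. g (i, x)) = (\<lambda>i\<in>residues. \<Sum>x\<in>?J. g' (i, x))"
        and "(\<lambda>j\<in>residues. \<Sum>i\<in>residues. g (i, Some j)) = (\<lambda>j\<in>residues. \<Sum>i\<in>residues. g' (i, Some j))"
        unfolding \<mu>_def prod.inject by blast+
      note eqs = this[THEN fun_cong]
      have "margins g = margins g'"
        unfolding margins_eq_iff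
      proof (intro conjI ballI)
        fix i assume "i \<in> residues"
        then show "(\<Sum>x\<in>?J. g (i, x)) = (\<Sum>x\<in>?J. g' (i, x))" using eqs(1)[of i] by (simp only: restrict_apply if_True)
      next
        fix x assume x: "x \<in> ?J"
        show "(\<Sum>i\<in>residues. g (i, x)) = (\<Sum>i\<in>residues. g' (i, x))"
        proof (cases x)
          case None
          then show ?thesis using g by (simp add: noncrossing_arrays_def open_sum_def)
        next
          case (Some j)
          then have "j \<in> residues" using x by auto
          then show ?thesis using eqs(2)[of j] Some by (simp only: restrict_apply if_True)
        qed
      qed
      then show "g = g'" using inj_on_margins g by (auto simp: noncrossing_arrays_def inj_on_def)
    qed
    show "\<mu> ` noncrossing_arrays p e = compositions residues (p + e) \<times> compositions residues p"
    proof (intro equalityI image_subsetI subsetI)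
      fix g assume g: "g \<in> noncrossing_arrays p e"
      have "(\<Sum>i\<in>residues. \<Sum>x\<in>?J. g (i, x)) = p + e"
        using g by (simp only: sum_columns sum.distrib)
          (simp add: noncrossing_arrays_def open_sum_def closed_sum_def)
      moreover have "(\<Sum>j\<in>residues. \<Sum>i\<in>residues. g (i, Some j)) = p"
        using g by (subst sum.swap) (simp add: noncrossing_arrays_def closed_sum_def)
      ultimately show "\<mu> g \<in> compositions residues (p + e) \<times> compositions residues p"
        unfolding \<mu>_def compositions_def by (simp add: sum_restrict del: sum.insert)
    next
      fix w assume "w \<in> compositions residues (p + e) \<times> compositions residues p"
      then obtain r c where w: "w = (r, c)" and r: "r \<in> compositions residues (p + e)"
        and c: "c \<in> compositions residues p" by auto
      \<comment> \<open>The closings are completed by \<open>e\<close> copies of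
        \<open>None\<close>, so that openings and column labels can be paired one to one.\<close>
      define c' where "c' = (\<lambda>x\<in>?J. case x of None \<Rightarrow> e | Some j \<Rightarrow> c j)"
      have "sum c' ?J = e + sum c residues"
        unfolding sum_columns by (auto simp: c'_def intro!: sum.cong)
      then have c': "c' \<in> compositions ?J (p + e)" using c by (simp add: compositions_def c'_def)
      obtain u where u: "\<And>s. s < p + e \<Longrightarrow> u s \<in> residues"
        "\<And>i. i \<in> residues \<Longrightarrow> card {s. s < p + e \<and> u s = i} = r i"
        by (rule ex_word[OF _ r]) auto
      obtain v where v: "\<And>s. s < p + e \<Longrightarrow> v s \<in> ?J"
        "\<And>x. x \<in> ?J \<Longrightarrow> card {s. s < p + e \<and> v s = x} = c' x"
        by (rule ex_word[OF _ c']) auto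
      define h where "h = (\<lambda>(i, x). card {s. s < p + e \<and> u s = i \<and> v s = x})"
      have "h p' = 0" if "p' \<notin> cyclic_arcs N" for p'
      proof -
        have "{s. s < p + e \<and> u s = fst p' \<and> v s = snd p'} = {}"
          using that u(1) v(1) by (cases p') (force simp: cyclic_arcs_def)
        then show ?thesis by (simp add: h_def case_prod_unfold)
      qed
      then have "h \<in> arrays" unfolding arrays_def by blast
      then have "margins h \<in> margins ` noncrossing"
        using bij_betw_imp_surj_on[OF bij_betw_margins] by blast
      then obtain g where g: "margins g = margins h" "g \<in> noncrossing" by (rule imageE) simp
      have rows: "(\<Sum>x\<in>?J. g (i, x)) = r i" if i: "i \<in> residues" for i
      proof -
        have "(\<Sum>x\<in>?J. g (i, x)) = (\<Sum>x\<in>?J. h (i, x))"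
          using g(1) i by (simp only: margins_eq_iff)
        also have "\<dots> = card {s. s < p + e \<and> u s = i}"
          unfolding h_def prod.case by (rule sum_card_fibres) (use v in auto)
        finally show ?thesis using u(2)[OF i] by simp
      qed
      have cols: "(\<Sum>i\<in>residues. g (i, x)) = c' x" if x: "x \<in> ?J" for x
      proof -
        have "(\<Sum>i\<in>residues. g (i, x)) = (\<Sum>i\<in>residues. h (i, x))"
          using g(1) x by (simp only: margins_eq_iff)
        also have "\<dots> = (\<Sum>i\<in>residues. card {s. s < p + e \<and> v s = x \<and> u s = i})"
          by (simp add: h_def conj_commute)
        also have "\<dots> = card {s. s < p + e \<and> v s = x}"
          by (rule sum_card_fibres) (use u in auto)
        finally show ?thesis using v(2)[OF x] by simp
      qed
      have "open_sum g = e" using cols[of None] by (simp add: open_sum_def c'_def)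
      moreover have "closed_sum g = p"
      proof -
        have "closed_sum g = (\<Sum>j\<in>residues. \<Sum>i\<in>residues. g (i, Some j))"
          unfolding closed_sum_def by (rule sum.swap)
        also have "\<dots> = sum c residues"
          using cols by (intro sum.cong refl) (auto simp: c'_def)
        finally show ?thesis using c by (simp add: compositions_def)
      qed
      ultimately have "g \<in> noncrossing_arrays p e" using g by (simp add: noncrossing_arrays_def)
      moreover have "\<mu> g = w"
        unfolding \<mu>_def w
      proof (intro arg_cong2[where f = Pair])
        show "(\<lambda>i\<in>residues. \<Sum>x\<in>?J. g (i, x)) = r"
          by (rule extensionalityI[of _ residues])
            (use rows r in \<open>auto simp: compositions_def PiE_iff simp del: sum.insert\<close>)
        show "(\<lambda>j\<in>residues. \<Sum>i\<in>residues. g (i, Some j)) = c"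
          by (rule extensionalityI[of _ residues])
            (use cols c in \<open>auto simp: compositions_def PiE_iff c'_def\<close>)
      qed
      ultimately show "w \<in> \<mu> ` noncrossing_arrays p e" by blast
    qed
  qed
  then show ?thesis by (simp add: bij_betw_same_card card_cartesian_product)
qed

section \<open>Dissections built from noncrossing arrays modulo N\<close>

definition arc :: "(int \<times> int option \<Rightarrow> nat) \<Rightarrow> int \<Rightarrow> int \<Rightarrow> bool" where
  "arc g a b \<longleftrightarrow> a < b \<and> b \<le> a + int N \<and> (g (a mod int N, Some (b mod int N)) \<noteq> 0 \<or>
     m = 2 \<and> b = a + int N \<and> g (a mod int N, None) \<noteq> 0)"

lemma arc_shift: "arc g (a - int n) b \<longleftrightarrow> arc g a (b + int n)"
  unfolding arc_def mod_n_shift by auto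

lemma noncrossing_pair:
  assumes "g \<in> noncrossing" "arcs_cross N p q"
  shows "g p = 0 \<or> g q = 0"
proof -
  have "\<forall>p q. arcs_cross N p q \<longrightarrow> g p = 0 \<or> g q = 0"
    using assms(1) by (simp add: noncrossing_def del: split_paired_All)
  from this[rule_format, OF assms(2)] show ?thesis .
qed

lemma open_at_most_one:
  assumes "open_sum g \<le> 1" "i \<in> residues" "k \<in> residues" "g (i, None) \<noteq> 0" "g (k, None) \<noteq> 0"
  shows "i = k"
proof (rule ccontr)
  assume "i \<noteq> k"
  then have "g (i, None) + g (k, None) = (\<Sum>l\<in>{i, k}. g (l, None))" by simp
  also have "\<dots> \<le> open_sum g"
    unfolding open_sum_def by (rule sum_mono2) (use assms in auto)
  finally show False using assms by linarith
qed

text \<open>An open arc is drawn as a diameter of length \<open>N\<close> but reaches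
  \<open>2 N\<close> in \<open>arcs_cross\<close>, so it still crosses whatever its diameter
  crosses. Two crossing diameters cannot both come from open arcs, since at most one residue carries
  such an arc.\<close>

lemma arcs_noncrossing:
  assumes g: "g \<in> noncrossing" "open_sum g \<le> 1"
    and arcs: "arc g a b" "arc g c d" and o: "a < c" "c < b" "b < d"
  shows False
proof -
  have lens: "a < b" "b \<le> a + int N" "c < d" "d \<le> c + int N" using arcs by (auto simp: arc_def)
  have la: "arc_length N (a mod int N, Some (b mod int N)) = b - a"
    and lc: "arc_length N (c mod int N, Some (d mod int N)) = d - c"
    using lens by (simp_all add: gap_of_mod gap_diff)
  consider (cc) "g (a mod int N, Some (b mod int N)) \<noteq> 0" "g (c mod int N, Some (d mod int N)) \<noteq> 0"
    | (co) "g (a mod int N, Some (b mod int N)) \<noteq> 0" "g (c mod int N, None) \<noteq> 0" "d = c + int N"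
    | (oc) "g (a mod int N, None) \<noteq> 0" "b = a + int N" "g (c mod int N, Some (d mod int N)) \<noteq> 0"
    | (oo) "g (a mod int N, None) \<noteq> 0" "b = a + int N" "g (c mod int N, None) \<noteq> 0"
    using arcs unfolding arc_def by blast
  then show False
  proof cases
    case cc
    have "arcs_cross N (a mod int N, Some (b mod int N)) (c mod int N, Some (d mod int N))"
      by (rule arcs_crossI) (use o in \<open>simp_all only: la lc, auto\<close>)
    from noncrossing_pair[OF g(1) this] show False using cc by simp
  next
    case co
    have "arcs_cross N (a mod int N, Some (b mod int N)) (c mod int N, None)"
      by (rule arcs_crossI) (use o co M_pos in \<open>simp_all only: la arc_length.simps(2), auto\<close>)
    from noncrossing_pair[OF g(1) this] show False using co by simp
  next
    case oc
    \<comment> \<open>The open arc is taken with the lift that starts at the other end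
      \<open>a + N\<close> of its diameter, which lies between \<open>c\<close> and
      \<open>d\<close>.\<close>
    have "arcs_cross N (c mod int N, Some (d mod int N)) ((a + int N) mod int N, None)"
      by (rule arcs_crossI) (use o oc lens M_pos in \<open>simp_all only: lc arc_length.simps(2), auto\<close>)
    from noncrossing_pair[OF g(1) this] show False using oc by simp
  next
    case oo
    have "a mod int N = c mod int N"
      by (rule open_at_most_one[OF g(2)]) (use oo M_pos in auto)
    then have "int N dvd c - a" unfolding mod_eq_dvd_iff by (metis dvd_diff_commute)
    then show False using zdvd_not_zless[of "c - a" "int N"] o oo by simp
  qed
qed

text \<open>If \<open>m = 2\<close>, a diameter is counted by both of the first two summands, so the closed
  arc carries half of its multiplicity and the open arc the parity.\<close>

definition edge_value :: "(int \<times> int option \<Rightarrow> nat) \<Rightarrow> int \<Rightarrow> int \<Rightarrow> nat" where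
  "edge_value g a b =
     (if gap (int n) a b \<le> int N then g (a mod int N, Some (b mod int N)) else 0) +
     (if gap (int n) b a \<le> int N then g (b mod int N, Some (a mod int N)) else 0) +
     (if m = 2 \<and> gap (int n) a b = int N then g (a mod int N, None) else 0)"

lemma gap_n_swap: "a < b \<Longrightarrow> b < a + int n \<Longrightarrow> gap (int n) b a = a + int n - b"
  by (rule gap_eqI) auto

lemma edge_value_cong:
  assumes "a mod int n = a' mod int n" "b mod int n = b' mod int n"
  shows "edge_value g a b = edge_value g a' b'"
proof -
  have "gap (int n) a b = gap (int n) a' b'" "gap (int n) b a = gap (int n) b' a'"
    using assms by (auto intro!: gap_cong simp: mod_eq_dvd_iff)
  then show ?thesis using mod_n_eq[OF assms(1)] mod_n_eq[OF assms(2)] by (simp add: edge_value_def)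
qed

lemma ex_lift:
  assumes "a mod int n \<noteq> b mod int n"
  obtains b' where "b mod int n = b' mod int n" "a < b'" "b' < a + int n"
proof -
  have bd: "1 \<le> gap (int n) a b" "gap (int n) a b \<le> int n"
    using gap_bounds[of "int n" a b] n_pos by simp_all
  have d: "int n dvd b - (a + gap (int n) a b)"
    using gap_dvd[of "int n" b a] by (simp add: algebra_simps)
  then have eq: "b mod int n = (a + gap (int n) a b) mod int n" unfolding mod_eq_dvd_iff .
  have "gap (int n) a b \<noteq> int n" using eq assms by auto
  then show ?thesis using that[OF eq] bd by auto
qed

text \<open>Only the third summand is asymmetric, and it is active for diameters alone, whose ends
  have the same residue modulo \<open>N\<close>.\<close>

lemma edge_value_commute:
  assumes "a mod int n \<noteq> b mod int n"
  shows "edge_value g a b = edge_value g b a"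
proof -
  obtain b' where b': "b mod int n = b' mod int n" "a < b'" "b' < a + int n"
    by (rule ex_lift[OF assms])
  have gaps: "gap (int n) a b' = b' - a" "gap (int n) b' a = a + int n - b'"
    using b' gap_diff[of a b' "int n"] gap_n_swap by auto
  have "edge_value g a b' = edge_value g b' a"
  proof (cases "m = 2 \<and> b' = a + int N")
    case True
    then have "b' mod int N = a mod int N" by simp
    moreover have "int n = 2 * int N" using True n_eq_iff by simp
    ultimately show ?thesis using True unfolding edge_value_def gaps by simp
  next
    case False
    then have "(m = 2 \<and> b' - a = int N) = False" "(m = 2 \<and> a + int n - b' = int N) = False"
      using n_eq_iff by auto
    then show ?thesis unfolding edge_value_def gaps by (simp only: if_False add_0_right add.commute)
  qed
  then show ?thesis using edge_value_cong[OF refl b'(1)] edge_value_cong[OF b'(1) refl] by metis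
qed

text \<open>\<open>Min\<close> and \<open>Max\<close> merely choose an order of the two ends;
  \<open>edge_value_commute\<close> makes the value independent of it.\<close>

definition dissection :: "(int \<times> int option \<Rightarrow> nat) \<Rightarrow> int set \<Rightarrow> nat" where
  "dissection g = (\<lambda>e\<in>polygon_edges n. edge_value g (Min e) (Max e))"

lemma dissection_edge:
  assumes ab: "a mod int n \<noteq> b mod int n"
  shows "dissection g (edge n a b) = edge_value g a b"
proof -
  have v: "vertex n c mod int n = c mod int n" for c
  proof -
    have "vertex n (vertex n c) = vertex n c" using vertex_in[OF n_pos] by (intro vertex_id)
    then show ?thesis by (simp only: vertex_eq_iff)
  qed
  have eq: "edge_value g (vertex n a) (vertex n b) = edge_value g a b"
    "edge_value g (vertex n b) (vertex n a) = edge_value g b a"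
    by (rule edge_value_cong; rule v)+
  have "edge n a b \<in> polygon_edges n" using ab n_pos by (simp add: edge_in_polygon_edges)
  then have "dissection g (edge n a b) = edge_value g (Min (edge n a b)) (Max (edge n a b))"
    by (simp add: dissection_def)
  also have "\<dots> = edge_value g a b"
  proof (cases "vertex n a \<le> vertex n b")
    case True
    then have "Min (edge n a b) = vertex n a" "Max (edge n a b) = vertex n b" by (simp_all add: edge_def)
    then show ?thesis using eq by simp
  next
    case False
    then have "Min (edge n a b) = vertex n b" "Max (edge n a b) = vertex n a" by (simp_all add: edge_def)
    then show ?thesis using eq edge_value_commute[OF ab] by simp
  qed
  finally show ?thesis .
qed

lemma lift_ne: "a < b \<Longrightarrow> b < a + int n \<Longrightarrow> a mod int n \<noteq> b mod int n"
  using zdvd_not_zless[of "b - a" "int n"] unfolding mod_eq_dvd_iff by (auto simp: dvd_diff_commute)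

lemma edge_value_arc:
  assumes "a < b" "b < a + int n" "edge_value g a b \<noteq> 0"
  shows "arc g a b \<or> arc g b (a + int n)"
proof -
  have gaps: "gap (int n) a b = b - a" "gap (int n) b a = a + int n - b"
    using assms gap_diff[of a b "int n"] gap_n_swap by auto
  show ?thesis
    using assms unfolding edge_value_def gaps arc_def mod_n_shift by (auto split: if_splits)
qed

text \<open>Each of the two edges may carry arcs in either direction; in all four combinations
  interleaved edges give interleaved arcs, after a shift by \<open>n\<close> where
  necessary.\<close>

lemma edge_value_noncrossing:
  assumes g: "g \<in> noncrossing" "open_sum g \<le> 1" and o: "a < c" "c < b" "b < d" "d < a + int n"
  shows "edge_value g a b = 0 \<or> edge_value g c d = 0"
proof (rule ccontr)
  assume "\<not> ?thesis"
  then have "arc g a b \<or> arc g b (a + int n)" "arc g c d \<or> arc g d (c + int n)"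
    using edge_value_arc[of a b g] edge_value_arc[of c d g] o by auto
  moreover have "arc g d (c + int n) \<longleftrightarrow> arc g (d - int n) c"
    by (rule arc_shift[symmetric])
  ultimately show False
    using arcs_noncrossing[OF g, of a b c d] arcs_noncrossing[OF g, of "d - int n" c a b]
      arcs_noncrossing[OF g, of c d b "a + int n"]
      arcs_noncrossing[OF g, of b "a + int n" d "c + int n"] o by auto
qed

text \<open>The share of one direction in \<open>edge_value\<close>, so that a sum over edges
  becomes a sum over ordered pairs of vertices.\<close>

definition half_value :: "(int \<times> int option \<Rightarrow> nat) \<Rightarrow> int \<Rightarrow> int \<Rightarrow> nat" where
  "half_value g a b = (if gap (int n) a b \<le> int N then g (a mod int N, Some (b mod int N)) else 0)"

lemma sum_half_value: "(\<Sum>b\<in>{1..int n}. half_value g a b) = (\<Sum>j\<in>residues. g (a mod int N, Some j))"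
proof -
  have "(\<Sum>b\<in>{1..int n}. half_value g a b) =
    (\<Sum>b\<in>{b \<in> {1..int n}. gap (int n) a b \<le> int N}. g (a mod int N, Some (b mod int N)))"
    unfolding half_value_def by (rule sum.inter_filter[symmetric]) simp
  also have "\<dots> = (\<Sum>c\<in>{a + 1..a + int N}. g (a mod int N, Some (c mod int N)))"
  proof (rule sum.reindex_bij_witness[where i = "vertex n" and j = "\<lambda>b. a + gap (int n) a b"])
    fix b assume b: "b \<in> {b \<in> {1..int n}. gap (int n) a b \<le> int N}"
    have "int n dvd b - (a + gap (int n) a b)"
      using gap_dvd[of "int n" b a] by (simp add: algebra_simps)
    then have e: "b mod int n = (a + gap (int n) a b) mod int n" unfolding mod_eq_dvd_iff .
    then have "vertex n b = vertex n (a + gap (int n) a b)" by (simp only: vertex_eq_iff)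
    then show "vertex n (a + gap (int n) a b) = b" using b vertex_id[of b n] by simp
    show "a + gap (int n) a b \<in> {a + 1..a + int N}" using b gap_bounds[of "int n" a b] n_pos by simp
    show "g (a mod int N, Some ((a + gap (int n) a b) mod int N)) = g (a mod int N, Some (b mod int N))"
      using mod_n_eq[OF e] by simp
  next
    fix c assume c: "c \<in> {a + 1..a + int N}"
    have "vertex n (vertex n c) = vertex n c" using vertex_in[OF n_pos] by (intro vertex_id)
    then have "vertex n c mod int n = c mod int n" by (simp only: vertex_eq_iff)
    then have "gap (int n) a (vertex n c) = gap (int n) a c"
      by (intro gap_cong) (simp_all add: mod_eq_dvd_iff)
    also have "\<dots> = c - a" by (rule gap_diff) (use c n_ge M_pos in auto)
    finally have *: "gap (int n) a (vertex n c) = c - a" .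
    then show "a + gap (int n) a (vertex n c) = c" by simp
    show "vertex n c \<in> {b \<in> {1..int n}. gap (int n) a b \<le> int N}"
      using vertex_in[OF n_pos, of c] c * by auto
  qed
  also have "\<dots> = (\<Sum>j\<in>residues. g (a mod int N, Some j))"
    by (rule sum_residues[OF N])
  finally show ?thesis .
qed

text \<open>Both directions of all edges run through all ordered pairs, and every residue has
  \<open>m\<close> representatives among the vertices. For \<open>m = 2\<close> open arcs are
  counted once: the diameters have their smaller ends at \<open>1\<close> to \<open>N\<close>, one
  for each residue.\<close>

lemma sum_dissection:
  "sum (dissection g) (polygon_edges n) = m * closed_sum g + (if m = 2 then open_sum g else 0)"
proof -
  define L where "L = {(a, b). 1 \<le> a \<and> a < b \<and> b \<le> int n}"
  define U where "U = {(a, b). 1 \<le> b \<and> b < a \<and> a \<le> int n}"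
  define D where "D = {(a, b). 1 \<le> a \<and> a = b \<and> b \<le> int n}"
  have fin: "finite L" "finite U" "finite D"
    by (rule finite_subset[of _ "{1..int n} \<times> {1..int n}"]; auto simp: L_def U_def D_def)+
  have "sum (dissection g) (polygon_edges n) = (\<Sum>(a, b)\<in>L. edge_value g a b)"
  proof -
    have "sum (dissection g) (polygon_edges n) = (\<Sum>p\<in>L. dissection g (case p of (a, b) \<Rightarrow> edge n a b))"
      unfolding L_def by (rule sum.reindex_bij_betw[OF bij_betw_edges, symmetric])
    also have "\<dots> = (\<Sum>(a, b)\<in>L. edge_value g a b)"
    proof (intro sum.cong refl, clarify)
      fix a b assume "(a, b) \<in> L"
      then show "dissection g (edge n a b) = edge_value g a b"
        by (intro dissection_edge lift_ne) (auto simp: L_def)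
    qed
    finally show ?thesis .
  qed
  also have "\<dots> = (\<Sum>(a, b)\<in>L. half_value g a b) + (\<Sum>(a, b)\<in>L. half_value g b a) +
     (\<Sum>(a, b)\<in>L. if m = 2 \<and> gap (int n) a b = int N then g (a mod int N, None) else 0)"
    unfolding edge_value_def half_value_def case_prod_unfold by (simp only: sum.distrib)
  also have "(\<Sum>(a, b)\<in>L. half_value g b a) = (\<Sum>(a, b)\<in>U. half_value g a b)"
    by (rule sum.reindex_bij_witness[of _ prod.swap prod.swap]) (auto simp: L_def U_def)
  also have "(\<Sum>(a, b)\<in>L. half_value g a b) + (\<Sum>(a, b)\<in>U. half_value g a b) = m * closed_sum g"
  proof -
    \<comment> \<open>Diagonal pairs may be added because \<open>gap\<close> gives them length
      \<open>n\<close>, which exceeds \<open>N\<close>.\<close>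
    have "(\<Sum>(a, b)\<in>D. half_value g a b) = 0"
    proof (rule sum.neutral, clarify)
      fix a b assume "(a, b) \<in> D"
      then have "gap (int n) a b = int n"
        using n_pos by (intro gap_eqI) (auto simp: D_def)
      then show "half_value g a b = 0" using n_ge M_pos by (simp add: half_value_def)
    qed
    then have "(\<Sum>(a, b)\<in>L. half_value g a b) + (\<Sum>(a, b)\<in>U. half_value g a b) =
      (\<Sum>(a, b)\<in>L \<union> U \<union> D. half_value g a b)"
      by (subst sum.union_disjoint, use fin in \<open>auto simp: L_def U_def D_def\<close>)+
    also have "L \<union> U \<union> D = {1..int n} \<times> {1..int n}"
      by (auto simp: L_def U_def D_def)
    also have "(\<Sum>(a, b)\<in>{1..int n} \<times> {1..int n}. half_value g a b) =
      (\<Sum>a\<in>{1..int n}. \<Sum>b\<in>{1..int n}. half_value g a b)"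
      by (rule sum.cartesian_product[symmetric])
    also have "\<dots> = (\<Sum>a\<in>{1..int n}. \<Sum>j\<in>residues. g (a mod int N, Some j))"
      by (simp only: sum_half_value)
    also have "\<dots> = m * closed_sum g"
      unfolding closed_sum_def n by (rule sum_residues_repeated[OF N])
    finally show ?thesis .
  qed
  also have "(\<Sum>(a, b)\<in>L. if m = 2 \<and> gap (int n) a b = int N then g (a mod int N, None) else 0) =
     (if m = 2 then open_sum g else 0)"
  proof (cases "m = 2")
    case True
    have "(\<Sum>(a, b)\<in>L. if m = 2 \<and> gap (int n) a b = int N then g (a mod int N, None) else 0) =
      (\<Sum>p\<in>L. if gap (int n) (fst p) (snd p) = int N then g (fst p mod int N, None) else 0)"
      using True by (simp add: case_prod_unfold)
    also have "\<dots> = (\<Sum>p\<in>{p \<in> L. gap (int n) (fst p) (snd p) = int N}. g (fst p mod int N, None))"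
      by (rule sum.inter_filter[symmetric]) (rule fin)
    also have "\<dots> = (\<Sum>a\<in>{0 + 1..0 + int N}. g (a mod int N, None))"
    proof (rule sum.reindex_bij_witness[where i = "\<lambda>a. (a, a + int N)" and j = fst])
      fix p assume p: "p \<in> {p \<in> L. gap (int n) (fst p) (snd p) = int N}"
      then have "gap (int n) (fst p) (snd p) = snd p - fst p"
        by (intro gap_diff) (auto simp: L_def)
      then have "snd p = fst p + int N" using p by auto
      then show "(fst p, fst p + int N) = p" "fst p \<in> {0 + 1..0 + int N}"
        using p n_eq_iff True by (auto simp: L_def prod_eq_iff)
    next
      fix a assume a: "a \<in> {0 + 1..0 + int N}"
      then have "gap (int n) a (a + int N) = a + int N - a"
        using n_ge M_pos by (intro gap_diff) auto
      then show "(a, a + int N) \<in> {p \<in> L. gap (int n) (fst p) (snd p) = int N}"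
        using a n_ge M_pos by (auto simp: L_def)
    qed auto
    also have "\<dots> = open_sum g"
      unfolding open_sum_def by (rule sum_residues[OF N])
    finally show ?thesis using True by simp
  qed simp
  finally show ?thesis .
qed

section \<open>Arrays read off from invariant dissections\<close>

definition invariant_dissections :: "nat \<Rightarrow> (int set \<Rightarrow> nat) set" where
  "invariant_dissections k = {f \<in> A_multidissections n k.
     \<forall>a b. f (edge n (a + int N) (b + int N)) = f (edge n a b)}"

text \<open>The inverse of \<open>dissection\<close>. With \<open>m = 2\<close> the arc from
  \<open>i\<close> to itself is the diameter; every other closed arc is an edge followed along its
  short direction.\<close>

definition arc_array :: "(int set \<Rightarrow> nat) \<Rightarrow> int \<times> int option \<Rightarrow> nat" where
  "arc_array f p = (if p \<in> cyclic_arcs N then case p of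
      (i, Some j) \<Rightarrow> if m = 2 \<and> i = j then f (edge n i (i + int N)) div 2
        else f (edge n i (i + gap (int N) i j))
    | (i, None) \<Rightarrow> if m = 2 then f (edge n i (i + int N)) mod 2 else 0 else 0)"

lemma invariant_multiple:
  assumes "f \<in> invariant_dissections k"
  shows "f (edge n (a + int N * t) (b + int N * t)) = f (edge n a b)"
proof -
  have step: "f (edge n (a + int N) (b + int N)) = f (edge n a b)" for a b
    using assms by (simp add: invariant_dissections_def)
  have pos: "f (edge n (a + int N * int r) (b + int N * int r)) = f (edge n a b)" for a b r
  proof (induction r)
    case (Suc r)
    then show ?case using step[of "a + int N * int r" "b + int N * int r"]
      by (simp add: algebra_simps)
  qed simp
  show ?thesis
  proof (cases "t \<ge> 0")
    case True
    then show ?thesis using pos[of a "nat t" b] by simp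
  next
    case False
    then show ?thesis
      using pos[of "a + int N * t" "nat (- t)" "b + int N * t"] by simp
  qed
qed

lemma invariant_reduce:
  assumes "f \<in> invariant_dissections k"
  shows "f (edge n (a mod int N) (a mod int N + l)) = f (edge n a (a + l))"
proof -
  define t where "t = a div int N"
  have a: "a = a mod int N + int N * t" by (simp add: t_def)
  have "f (edge n (a mod int N + int N * t) (a mod int N + l + int N * t)) =
    f (edge n (a mod int N) (a mod int N + l))"
    by (rule invariant_multiple[OF assms])
  moreover have "a mod int N + l + int N * t = a + l" using a by linarith
  ultimately show ?thesis using a by simp
qed

lemma arc_array_closed:
  assumes f: "f \<in> invariant_dissections k" and "a < b" "b \<le> a + int N"
  shows "arc_array f (a mod int N, Some (b mod int N)) =
    (if m = 2 \<and> b = a + int N then f (edge n a b) div 2 else f (edge n a b))"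
proof -
  have in_arcs: "(a mod int N, Some (b mod int N)) \<in> cyclic_arcs N"
    using M_pos by (auto simp: cyclic_arcs_def)
  have "a mod int N = b mod int N \<longleftrightarrow> b = a + int N"
  proof
    assume "a mod int N = b mod int N"
    then have "b mod int N = a mod int N" by simp
    then have "int N dvd b - a" unfolding mod_eq_dvd_iff .
    then have "int N \<le> b - a" using assms by (intro zdvd_imp_le) auto
    then show "b = a + int N" using assms by simp
  qed simp
  moreover have "gap (int N) (a mod int N) (b mod int N) = b - a"
    using assms gap_of_mod gap_diff by simp
  ultimately show ?thesis
    using in_arcs invariant_reduce[OF f, of a "int N"] invariant_reduce[OF f, of a "b - a"]
    by (simp add: arc_array_def)
qed

lemma arc_array_open:
  assumes f: "f \<in> invariant_dissections k"
  shows "arc_array f (a mod int N, None) = (if m = 2 then f (edge n a (a + int N)) mod 2 else 0)"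
  using M_pos invariant_reduce[OF f, of a "int N"] by (simp add: arc_array_def cyclic_arcs_def)

lemma invariant_noncrossing:
  assumes "f \<in> invariant_dissections k" "a < c" "c < b" "b < d" "d < a + int n"
  shows "f (edge n a b) = 0 \<or> f (edge n c d) = 0"
proof -
  have "\<forall>a b c d. a < c \<and> c < b \<and> b < d \<and> d < a + int n \<longrightarrow>
      f (edge n a b) = 0 \<or> f (edge n c d) = 0"
    using assms(1) by (simp add: invariant_dissections_def A_multidissections_iff[OF n_pos])
  from this[rule_format, of a c b d] show ?thesis using assms by simp
qed

text \<open>Short edges and diameters are read back from their arcs by computation. An edge longer
  than \<open>N\<close> both ways has no arc, and must vanish by invariance and noncrossing.\<close>

lemma dissection_arc_array:
  assumes f: "f \<in> invariant_dissections k"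
  shows "dissection (arc_array f) = f"
proof (rule edge_functions_eqI[OF n_pos])
  fix a b assume ab: "a mod int n \<noteq> b mod int n"
  obtain b' where b': "b mod int n = b' mod int n" "a < b'" "b' < a + int n"
    by (rule ex_lift[OF ab])
  have gaps: "gap (int n) a b' = b' - a" "gap (int n) b' a = a + int n - b'"
    using b' gap_diff[of a b' "int n"] gap_n_swap by auto
  have "edge n b' (a + int n) = edge n b' a" by (rule edge_cong) simp_all
  then have e: "edge n a b = edge n a b'" "edge n b' (a + int n) = edge n a b'"
    using edge_cong[OF refl b'(1)] edge_commute[of n a b'] by simp_all
  have "edge_value (arc_array f) a b' = f (edge n a b')"
  proof -
    consider (near) "b' - a \<le> int N" "\<not> (m = 2 \<and> b' = a + int N)"
      | (diameter) "m = 2" "b' = a + int N"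
      | (far) "int N < b' - a" "a + int n - b' \<le> int N"
      | (none) "int N < b' - a" "int N < a + int n - b'"
      by linarith
    then show ?thesis
    proof cases
      case near
      have "\<not> a + int n - b' \<le> int N"
        using near n_ge n_ge3 M_pos n_eq_iff by (cases "m = 2") auto
      then show ?thesis
        using near arc_array_closed[OF f, of a b'] b' unfolding edge_value_def gaps by auto
    next
      case diameter
      have n2: "int n = 2 * int N" using diameter n_eq_iff by simp
      have 1: "arc_array f (a mod int N, Some (b' mod int N)) = f (edge n a b') div 2"
        using arc_array_closed[OF f, of a b'] diameter M_pos by simp
      have 2: "arc_array f (b' mod int N, Some (a mod int N)) = f (edge n a b') div 2"
        using arc_array_closed[OF f, of b' "a + int n"] diameter M_pos n2 e(2) mod_n_shift(1)[of a] by simp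
      have 3: "arc_array f (a mod int N, None) = f (edge n a b') mod 2"
        using arc_array_open[OF f, of a] diameter by simp
      have "edge_value (arc_array f) a b' =
        f (edge n a b') div 2 + f (edge n a b') div 2 + f (edge n a b') mod 2"
        unfolding edge_value_def gaps 1 2 3 using diameter n2 by simp
      then show ?thesis by presburger
    next
      case far
      have "\<not> (m = 2 \<and> a + int n = b' + int N)" using far n_eq_iff by auto
      then show ?thesis
        using far arc_array_closed[OF f, of b' "a + int n"] b' e(2) mod_n_shift(1)[of a]
        unfolding edge_value_def gaps by auto
    next
      case none
      have "f (edge n a b') = 0 \<or> f (edge n (a + int N) (b' + int N)) = 0"
        by (rule invariant_noncrossing[OF f]) (use none M_pos in auto)
      then have "f (edge n a b') = 0"
        using invariant_multiple[OF f, of a 1 b'] by simp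
      then show ?thesis using none unfolding edge_value_def gaps by simp
    qed
  qed
  then show "dissection (arc_array f) (edge n a b) = f (edge n a b)"
    using dissection_edge[OF ab] edge_value_cong[OF refl b'(1)] e(1) by simp
qed (use f in \<open>auto simp: dissection_def invariant_dissections_def extensional_A_multidissections\<close>)

lemma arc_array_noncrossing:
  assumes f: "f \<in> invariant_dissections k"
  shows "arc_array f \<in> noncrossing"
proof -
  have "arc_array f p = 0" if "p \<notin> cyclic_arcs N" for p
    using that by (simp add: arc_array_def)
  then have "arc_array f \<in> arrays" unfolding arrays_def by (simp del: split_paired_All)
  moreover have "arc_array f p = 0 \<or> arc_array f q = 0" if cr: "arcs_cross N p q" for p q
  proof (rule ccontr)
    assume "\<not> ?thesis"
    then have nz: "arc_array f p \<noteq> 0" "arc_array f q \<noteq> 0" by auto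
    then have S: "p \<in> cyclic_arcs N" "q \<in> cyclic_arcs N" by (auto simp: arc_array_def split: if_splits)
    obtain i x k y where pq: "p = (i, x)" "q = (k, y)" by (cases p, cases q)
    obtain j where x: "x = Some j" using cr pq by (auto simp: arcs_cross_def)
    define a where "a = gap (int N) i j"
    obtain t where t: "i < k + int N * t" "k + int N * t < i + a"
      "i + a < k + int N * t + arc_length N (k, y)"
      using cr by (auto simp: arcs_cross_def pq x a_def)
    have a: "1 \<le> a" "a \<le> int N" using gap_bounds[OF M_pos] by (simp_all add: a_def)
    have fp: "f (edge n i (i + a)) \<noteq> 0"
    proof -
      have "a = int N" if "i = j"
        unfolding a_def by (rule gap_eqI) (use that M_pos in auto)
      then show ?thesis
        using nz(1) S(1) unfolding pq x arc_array_def a_def by (auto split: if_splits)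
    qed
    \<comment> \<open>An open arc of formal length \<open>2 N\<close> is replaced by its diameter of
      length \<open>N\<close>; this still ends beyond the first arc because
      \<open>a \<le> N\<close>.\<close>
    obtain b where b: "b \<le> int N" "a < k + int N * t + b - i" "f (edge n k (k + b)) \<noteq> 0"
    proof (cases y)
      case None
      then have "f (edge n k (k + int N)) \<noteq> 0"
        using nz(2) S(2) unfolding pq arc_array_def by (auto split: if_splits)
      then show ?thesis using that[of "int N"] t a by simp
    next
      case (Some l)
      have "gap (int N) k l = int N" if "k = l"
        by (rule gap_eqI) (use that M_pos in auto)
      then have "f (edge n k (k + gap (int N) k l)) \<noteq> 0"
        using nz(2) S(2) unfolding pq Some arc_array_def by (auto split: if_splits)
      then show ?thesis using that[of "gap (int N) k l"] t gap_bounds(2)[OF M_pos, of k l] Some by simp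
    qed
    have "f (edge n i (i + a)) = 0 \<or> f (edge n (k + int N * t) (k + b + int N * t)) = 0"
      by (rule invariant_noncrossing[OF f]) (use t b a n_ge in auto)
    then show False using fp b(3) invariant_multiple[OF f, of k t "k + b"] by simp
  qed
  ultimately show ?thesis unfolding noncrossing_def by (simp del: split_paired_All)
qed

text \<open>Different diameters cross, so at most one can have odd multiplicity.\<close>

lemma open_sum_arc_array:
  assumes f: "f \<in> invariant_dissections k"
  shows "open_sum (arc_array f) \<le> 1" "m \<noteq> 2 \<Longrightarrow> open_sum (arc_array f) = 0"
proof -
  have val: "arc_array f (i, None) = (if m = 2 then f (edge n i (i + int N)) mod 2 else 0)"
    if "i \<in> residues" for i
    using arc_array_open[OF f, of i] that by simp
  show z: "open_sum (arc_array f) = 0" if "m \<noteq> 2"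
    using that val by (simp add: open_sum_def)
  show "open_sum (arc_array f) \<le> 1"
  proof (cases "m = 2 \<and> (\<exists>i\<in>residues. arc_array f (i, None) \<noteq> 0)")
    case True
    then obtain i where i: "i \<in> residues" "arc_array f (i, None) \<noteq> 0" by blast
    have n2: "int n = 2 * int N" using True n_eq_iff by simp
    have eq: "i' = k'" if "i' \<in> residues" "k' \<in> residues" "i' \<le> k'"
      "arc_array f (i', None) \<noteq> 0" "arc_array f (k', None) \<noteq> 0" for i' k'
    proof (rule ccontr)
      assume "i' \<noteq> k'"
      then have "f (edge n i' (i' + int N)) = 0 \<or> f (edge n k' (k' + int N)) = 0"
        using that n2 by (intro invariant_noncrossing[OF f]) auto
      then show False using that val True by auto
    qed
    have "arc_array f (k', None) = 0" if "k' \<in> residues - {i}" for k'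
      using eq[of i k'] eq[of k' i] that i by (cases "i \<le> k'") auto
    then have "open_sum (arc_array f) = arc_array f (i, None)"
      unfolding open_sum_def using i(1) by (subst sum.remove[of _ i]) auto
    also have "\<dots> \<le> 1" using val[OF i(1)] by (simp add: True)
    finally show ?thesis .
  next
    case False
    then have "open_sum (arc_array f) = 0"
      using z by (cases "m = 2") (auto simp: open_sum_def)
    then show ?thesis by simp
  qed
qed

text \<open>A diameter has multiplicity \<open>2 * g (i, Some i) + g (i, None)\<close>; quotient and
  remainder by 2 recover both entries because \<open>open_sum g \<le> 1\<close>.\<close>

lemma arc_array_dissection:
  assumes g: "g \<in> noncrossing" "open_sum g \<le> 1" "m \<noteq> 2 \<Longrightarrow> open_sum g = 0"
  shows "arc_array (dissection g) = g"
proof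
  fix p
  show "arc_array (dissection g) p = g p"
  proof (cases "p \<in> cyclic_arcs N")
    case False
    have "\<forall>p. p \<notin> cyclic_arcs N \<longrightarrow> g p = 0"
      using g(1) by (simp add: noncrossing_def arrays_def del: split_paired_All)
    from this[rule_format, OF False] show ?thesis using False by (simp add: arc_array_def)
  next
    case True
    obtain i x where p: "p = (i, x)" by (cases p)
    have i: "i \<in> residues" "i mod int N = i" using True by (auto simp: p cyclic_arcs_def)
    have near: "dissection g (edge n i (i + l)) = edge_value g i (i + l)"
      "gap (int n) i (i + l) = l" "gap (int n) (i + l) i = int n - l"
      if "1 \<le> l" "l \<le> int N" for l
    proof -
      have l: "i < i + l" "i + l < i + int n" using that n_ge M_pos by auto
      show "dissection g (edge n i (i + l)) = edge_value g i (i + l)"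
        by (rule dissection_edge[OF lift_ne[OF l]])
      show "gap (int n) i (i + l) = l" "gap (int n) (i + l) i = int n - l"
        using gap_diff[of i "i + l" "int n"] gap_n_swap[OF l] l by simp_all
    qed
    have open_le: "g (i, None) \<le> open_sum g"
      unfolding open_sum_def by (rule member_le_sum) (use i in auto)
    have diameter: "dissection g (edge n i (i + int N)) = 2 * g (i, Some i) + g (i, None)" if "m = 2"
    proof -
      have N1: "1 \<le> int N" and n2: "int n - int N = int N" using M_pos that n_eq_iff by auto
      show ?thesis
        unfolding near(1)[OF N1 order_refl] edge_value_def near(2,3)[OF N1 order_refl]
        using that n2 i(2) by simp
    qed
    show ?thesis
    proof (cases x)
      case None
      have S: "(i, None) \<in> cyclic_arcs N" using True by (simp add: p None)
      show ?thesis
        unfolding p None arc_array_def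
        using S diameter open_le g(2) g(3) by (cases "m = 2") auto
    next
      case (Some j)
      have j: "j \<in> residues" "j mod int N = j" using True by (auto simp: p Some cyclic_arcs_def)
      define l where "l = gap (int N) i j"
      have l: "1 \<le> l" "l \<le> int N" using gap_bounds[OF M_pos] by (simp_all add: l_def)
      have d: "int N dvd (i + l) - j"
        using gap_dvd[of "int N" j i] unfolding l_def by (metis diff_diff_eq dvd_diff_commute)
      then have lj: "(i + l) mod int N = j" using j(2) unfolding mod_eq_dvd_iff[symmetric] by simp
      show ?thesis
      proof (cases "m = 2 \<and> i = j")
        case True
        have S: "(i, Some j) \<in> cyclic_arcs N" using \<open>p \<in> cyclic_arcs N\<close> by (simp add: p Some)
        show ?thesis
          unfolding p Some arc_array_def using True S diameter open_le g(2) by simp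
      next
        case False
        \<comment> \<open>Diameters with \<open>m = 2\<close> are settled, so the opposite direction
          is too long to contribute.\<close>
        have "\<not> int n - l \<le> int N"
        proof (cases "m = 2")
          case True
          have "l \<noteq> int N" using lj i(2) False True by auto
          then show ?thesis using l n_eq_iff True by simp
        next
          case False
          then show ?thesis using n_ge3 l M_pos by simp
        qed
        moreover have "(m = 2 \<and> l = int N) = False" using lj i(2) False by auto
        ultimately have "edge_value g i (i + l) = g (i, Some j)"
          unfolding edge_value_def near(2,3)[OF l] i(2) lj using l by (simp only: if_True if_False)
        then show ?thesis
          using \<open>p \<in> cyclic_arcs N\<close> near(1)[OF l] False by (auto simp: p Some arc_array_def l_def)
      qed
    qed
  qed
qed

lemma dissection_invariant:
  assumes g: "g \<in> noncrossing" "open_sum g \<le> 1"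
    and k: "m * closed_sum g + (if m = 2 then open_sum g else 0) = k"
  shows "dissection g \<in> invariant_dissections k"
  unfolding invariant_dissections_def A_multidissections_iff[OF n_pos]
proof (intro CollectI conjI allI impI)
  fix a b c d assume o: "a < c \<and> c < b \<and> b < d \<and> d < a + int n"
  then have "a mod int n \<noteq> b mod int n" "c mod int n \<noteq> d mod int n"
    using lift_ne[of a b] lift_ne[of c d] by auto
  then show "dissection g (edge n a b) = 0 \<or> dissection g (edge n c d) = 0"
    using edge_value_noncrossing[OF g, of a c b d] o by (simp add: dissection_edge)
next
  fix a b
  have iff: "(a + int N) mod int n = (b + int N) mod int n \<longleftrightarrow> a mod int n = b mod int n"
    using mod_diff_cancel[of a "- int N"] by simp
  have gaps: "gap (int n) (a + int N) (b + int N) = gap (int n) a b"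
    "gap (int n) (b + int N) (a + int N) = gap (int n) b a"
    by (simp_all add: gap_def)
  show "dissection g (edge n (a + int N) (b + int N)) = dissection g (edge n a b)"
  proof (cases "a mod int n = b mod int n")
    case True
    then show ?thesis using iff n_pos by (simp add: dissection_def edge_in_polygon_edges)
  next
    case False
    then show ?thesis using iff by (simp add: dissection_edge edge_value_def gaps)
  qed
qed (use k in \<open>simp_all add: sum_dissection\<close>, simp add: dissection_def)

text \<open>At most one arc is open and \<open>m \<ge> 2\<close>, so the numbers of closed and open
  arcs are quotient and remainder of \<open>k\<close> by \<open>m\<close>; a nonzero remainder
  occurs only for \<open>m = 2\<close>.\<close>

lemma card_invariant_dissections:
  "card (invariant_dissections k) = (if k mod m = 0 \<or> m = 2
     then card (compositions residues (k div m + k mod m)) * card (compositions residues (k div m))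
     else 0)"
proof -
  define X where "X = {g \<in> noncrossing. open_sum g \<le> 1 \<and> (m \<noteq> 2 \<longrightarrow> open_sum g = 0) \<and>
    m * closed_sum g + open_sum g = k}"
  have "bij_betw arc_array (invariant_dissections k) X"
  proof (rule bij_betw_byWitness[where f' = dissection])
    show "\<forall>f\<in>invariant_dissections k. dissection (arc_array f) = f"
      using dissection_arc_array by blast
    show "\<forall>g\<in>X. arc_array (dissection g) = g"
      using arc_array_dissection by (simp add: X_def)
    show "dissection ` X \<subseteq> invariant_dissections k"
      using dissection_invariant by (auto simp: X_def)
    show "arc_array ` invariant_dissections k \<subseteq> X"
    proof (rule image_subsetI)
      fix f assume f: "f \<in> invariant_dissections k"
      have "sum (dissection (arc_array f)) (polygon_edges n) = k"
        using f unfolding dissection_arc_array[OF f]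
        by (simp add: invariant_dissections_def A_multidissections_def)
      then show "arc_array f \<in> X"
        using open_sum_arc_array[OF f] arc_array_noncrossing[OF f]
        by (auto simp: X_def sum_dissection split: if_splits)
    qed
  qed
  then have "card (invariant_dissections k) = card X" by (rule bij_betw_same_card)
  also have "X = (if k mod m = 0 \<or> m = 2 then noncrossing_arrays (k div m) (k mod m) else {})"
  proof -
    have dm: "m * c + e = k \<longleftrightarrow> c = k div m \<and> e = k mod m" if "e < m" for c e
      using that by auto
    have le: "e \<le> 1 \<Longrightarrow> e < m" for e using m by simp
    show ?thesis
    proof (cases "k mod m = 0 \<or> m = 2")
      case True
      then have "k mod m \<le> 1" "m \<noteq> 2 \<Longrightarrow> k mod m = 0" by auto
      then show ?thesis using True dm le by (auto simp: X_def noncrossing_arrays_def)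
    next
      case False
      then show ?thesis using dm[of 0] m by (auto simp: X_def)
    qed
  qed
  finally show ?thesis by (simp add: card_noncrossing_arrays)
qed

end

section \<open>Evaluation at roots of unity and comparison of the two counts\<close>

section \<open>Cyclic sieving\<close>

lemma poly_map_poly_sum_monom:
  fixes q :: complex
  shows "poly (map_poly of_nat (\<Sum>T\<in>A. monom (1::nat) (w T))) q = (\<Sum>T\<in>A. q ^ w T)"
proof (induction A rule: infinite_finite_induct)
  case (insert T A)
  have add: "map_poly of_nat (p + r) = map_poly of_nat p + (map_poly of_nat r :: complex poly)"
    for p r :: "nat poly"
    by (rule poly_eqI) (simp add: coeff_map_poly)
  have mon: "map_poly of_nat (monom (Suc 0) d) = (monom 1 d :: complex poly)" for d
    by (rule poly_eqI) (simp add: coeff_map_poly)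
  show ?case using insert by (simp add: add mon poly_monom)
qed simp_all

definition tableau_degree :: "nat \<Rightarrow> nat \<Rightarrow> (nat \<times> nat \<Rightarrow> nat) \<Rightarrow> nat" where
  "tableau_degree n k T = (\<Sum>i=1..n. (i - 1) * card {u \<in> cells [k, k]. T u = i})"

lemma schur_powers:
  fixes z :: "'a::comm_semiring_1"
  shows "schur [k, k] n (\<lambda>i. z ^ (i - 1)) = (\<Sum>T\<in>semistandard_tableaux [k, k] n. z ^ tableau_degree n k T)"
  unfolding schur_def tableau_degree_def by (simp add: power_mult[symmetric] power_sum)

text \<open>Entries of the second row are at least 2, so each contributes at least 1 to the degree;
  this is what makes \<open>q^(-k) s_(k,k)\<close> a polynomial.\<close>

lemma tableau_degree_ge:
  assumes T: "T \<in> semistandard_tableaux [k, k] n"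
  shows "k \<le> tableau_degree n k T"
proof -
  have T1: "T (1, s) \<in> {1..n}" "T (0, s) < T (1, s)" "1 \<le> T (0, s)" if "s < k" for s
    using T that unfolding semistandard_tableaux_two_rows by (auto simp: PiE_iff)
  have "k = card {s. s < k \<and> True}" by simp
  also have "\<dots> = (\<Sum>i=1..n. card {s. s < k \<and> True \<and> T (1, s) = i})"
    by (rule sum_card_fibres[symmetric]) (use T1 in auto)
  also have "\<dots> \<le> tableau_degree n k T"
    unfolding tableau_degree_def
  proof (rule sum_mono)
    fix i assume "i \<in> {1..n}"
    have "card {s. s < k \<and> True \<and> T (1, s) = i} = card (Pair 1 ` {s. s < k \<and> True \<and> T (1, s) = i} :: (nat \<times> nat) set)"
      by (simp add: card_image inj_on_def)
    also have "\<dots> \<le> (i - 1) * card {u \<in> cells [k, k]. T u = i}"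
    proof (cases "i \<le> 1")
      case True
      have e: "{s. s < k \<and> True \<and> T (1, s) = i} = {}"
        using True T1 by fastforce
      show ?thesis unfolding e by simp
    next
      case False
      have "finite {u \<in> cells [k, k]. T u = i}"
        by (rule finite_subset[of _ "{..<2} \<times> {..<k}"]) (auto simp: cells_two_rows)
      then have "card (Pair 1 ` {s. s < k \<and> True \<and> T (1, s) = i} :: (nat \<times> nat) set) \<le> card {u \<in> cells [k, k]. T u = i}"
        by (rule card_mono) (auto simp: cells_two_rows)
      also have "\<dots> = 1 * card {u \<in> cells [k, k]. T u = i}" by (rule mult_1[symmetric])
      also have "\<dots> \<le> (i - 1) * card {u \<in> cells [k, k]. T u = i}"
        by (rule mult_le_mono1) (use False in simp)
      finally show ?thesis .
    qed
    finally show "card {s. s < k \<and> True \<and> T (1, s) = i} \<le> (i - 1) * card {u \<in> cells [k, k]. T u = i}" .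
  qed
  finally show ?thesis .
qed

text \<open>The right side is arranged to match \<open>card_invariant_dissections\<close> factor by
  factor.\<close>

lemma schur_root_of_unity:
  assumes q: "root_of_unity_of_order m q" and m: "m \<ge> 2" and J: "finite J" and n: "n = m * card J"
  shows "schur [k, k] n (\<lambda>i. q ^ (i - 1)) = q ^ k * of_nat (if k mod m = 0 \<or> m = 2
     then card (compositions J (k div m + k mod m)) * card (compositions J (k div m)) else 0)"
proof -
  define c where "c a = (of_nat (card (compositions J a)) :: complex)" for a
  have h: "complete_hom {1..n} (\<lambda>i. q ^ (i - 1)) a = (if m dvd a then c (a div m) else 0)" for a
    using complete_hom_root_of_unity[OF q J n] by (simp add: c_def)
  have qm: "q ^ m = 1" using q by (simp add: root_of_unity_of_order_def)
  have s: "schur [k, k] n (\<lambda>i. q ^ (i - 1)) = (if m dvd k then c (k div m) ^ 2 else 0) -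
    (if m dvd Suc k then c (Suc k div m) else 0) *
    (if k = 0 then 0 else if m dvd (k - 1) then c ((k - 1) div m) else 0)"
    unfolding schur_two_rows ballot_sum_eq[OF order_refl] h by (simp add: power2_eq_square)
  consider (div) "m dvd k" | (odd) "m = 2" "odd k" | (other) "\<not> m dvd k" "m \<noteq> 2" by blast
  then show ?thesis
  proof cases
    case div
    then have "\<not> m dvd Suc k" using m dvd_diff_nat[of m "Suc k" k] by auto
    moreover have "q ^ k = 1" using div qm by (auto simp: power_mult)
    moreover have "k mod m = 0" using div by simp
    ultimately show ?thesis using div unfolding s by (simp add: c_def power2_eq_square)
  next
    case odd
    then obtain p where p: "k = 2 * p + 1" by (elim oddE)
    have "\<forall>j. 0 < j \<and> j < m \<longrightarrow> q ^ j \<noteq> 1"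
      using q by (simp add: root_of_unity_of_order_def)
    from this[rule_format, of 1] have "q \<noteq> 1" using odd(1) by simp
    moreover have "(q - 1) * (q + 1) = 0" using qm odd(1) by (simp add: algebra_simps power2_eq_square)
    ultimately have "q = -1" by (simp add: eq_neg_iff_add_eq_0)
    \<comment> \<open>Here \<open>q ^ k = -1\<close> absorbs the minus sign of the surviving second
      product, of degrees \<open>k + 1\<close> and \<open>k - 1\<close>.\<close>
    then show ?thesis unfolding s using odd by (simp add: p c_def)
  next
    case other
    then have "m \<ge> 3" using m by simp
    have "\<not> (m dvd Suc k \<and> m dvd (k - 1) \<and> k \<noteq> 0)"
    proof
      assume *: "m dvd Suc k \<and> m dvd (k - 1) \<and> k \<noteq> 0"
      then have "m dvd Suc k - (k - 1)" by (auto simp only: intro: dvd_diff_nat)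
      moreover have "Suc k - (k - 1) = 2" using * by simp
      ultimately have "m \<le> 2" by (auto dest: dvd_imp_le)
      then show False using \<open>m \<ge> 3\<close> by simp
    qed
    then have z: "(if m dvd Suc k then c (Suc k div m) else 0) *
      (if k = 0 then 0 else if m dvd (k - 1) then c ((k - 1) div m) else 0) = 0"
      by (simp only: split: if_split) simp
    have "k mod m \<noteq> 0" using other(1) by (simp add: dvd_eq_mod_eq_0)
    then show ?thesis unfolding s z using other by simp
  qed
qed

lemma root_of_unity_power:
  assumes \<zeta>: "root_of_unity_of_order n \<zeta>" and n: "n = m * N" "N = gcd n d"
  shows "root_of_unity_of_order m (\<zeta> ^ d)"
proof -
  have n0: "n > 0" and one: "\<zeta> ^ n = 1" and min: "\<And>j. 0 < j \<Longrightarrow> j < n \<Longrightarrow> \<zeta> ^ j \<noteq> 1"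
    using \<zeta> by (auto simp: root_of_unity_of_order_def)
  have dvd: "n dvd j" if "\<zeta> ^ j = 1" for j
  proof -
    have "\<zeta> ^ j = \<zeta> ^ (n * (j div n) + j mod n)" by simp
    also have "\<dots> = \<zeta> ^ (j mod n)" using one by (simp only: power_add power_mult) simp
    finally have "\<zeta> ^ (j mod n) = 1" using that by simp
    then have "\<not> 0 < j mod n" using min[of "j mod n"] n0 by auto
    then have "j mod n = 0" by (simp only: not_gr_zero)
    then show ?thesis by (simp only: mod_eq_0_iff_dvd)
  qed
  have N0: "N > 0" using n0 n(1) by simp
  have "N dvd d" using n(2) by simp
  then obtain d' where d': "d = N * d'" by (rule dvdE)
  have cop: "coprime m d'"
  proof -
    have "N * gcd m d' = gcd (N * m) (N * d')" by (rule gcd_mult_distrib_nat)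
    also have "\<dots> = gcd n d" by (simp only: n(1) d' mult.commute)
    also have "\<dots> = N" by (rule n(2)[symmetric])
    finally have "gcd m d' = 1" using N0 by simp
    then show ?thesis by (simp only: coprime_iff_gcd_eq_1)
  qed
  have "(\<zeta> ^ d) ^ m = (\<zeta> ^ n) ^ d'"
    by (simp add: power_mult[symmetric] n(1) d' mult_ac)
  moreover have "(\<zeta> ^ d) ^ j \<noteq> 1" if "0 < j" "j < m" for j
  proof
    assume "(\<zeta> ^ d) ^ j = 1"
    then have "n dvd d * j" by (intro dvd) (simp add: power_mult)
    then have "N * m dvd N * (d' * j)" using n(1) d' by (simp add: mult_ac)
    then have "m dvd d' * j" using N0 by simp
    then have "m dvd j" using cop by (simp add: coprime_dvd_mult_right_iff)
    then show False using that by (auto dest: dvd_imp_le)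
  qed
  ultimately show ?thesis using one n0 n(1) unfolding root_of_unity_of_order_def by simp
qed

text \<open>By Bezout some multiple of \<open>d\<close> is congruent to \<open>gcd n d\<close>
  modulo \<open>n\<close>, so both shifts generate the same rotations.\<close>

lemma invariant_gcd_iff:
  assumes n: "n > 0"
  shows "(\<forall>a b. f (edge n (a + int d) (b + int d)) = f (edge n a b)) \<longleftrightarrow>
    (\<forall>a b. f (edge n (a + int (gcd n d)) (b + int (gcd n d))) = f (edge n a b))"
    (is "?L \<longleftrightarrow> ?R")
proof -
  have iter: "f (edge n (a + int e * int r) (b + int e * int r)) = f (edge n a b)"
    if "\<forall>a b. f (edge n (a + int e) (b + int e)) = f (edge n a b)" for a b e r
  proof (induction r)
    case (Suc r)
    then show ?case
      using that[rule_format, of "a + int e * int r" "b + int e * int r"] by (simp add: algebra_simps)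
  qed simp
  have shift: "edge n (a + int r) (b + int r) = edge n (a + int r') (b + int r')"
    if "r mod n = r' mod n" for a b r r'
  proof -
    have "int r mod int n = int r' mod int n"
      using that by (simp flip: zmod_int)
    then show ?thesis by (intro edge_cong) (rule mod_add_cong; simp)+
  qed
  show ?thesis
  proof
    assume L: ?L
    have "\<exists>x. d * x mod n = gcd n d mod n"
    \<comment> \<open>\<open>bezout_nat\<close> asks for a nonzero \<open>d\<close>; for
      \<open>d = 0\<close> the gcd is \<open>n\<close>, which is 0 modulo \<open>n\<close>.\<close>
    proof (cases "d = 0")
      case False
      then obtain x y where "d * x = n * y + gcd d n" using bezout_nat[of d n] by blast
      then have "d * x mod n = gcd n d mod n" by (simp add: gcd.commute)
      then show ?thesis ..
    qed simp
    then obtain x where "d * x mod n = gcd n d mod n" ..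
    then have "edge n (a + int (d * x)) (b + int (d * x)) = edge n (a + int (gcd n d)) (b + int (gcd n d))" for a b
      by (rule shift)
    then show ?R using iter[OF L, of _ x] by (simp add: algebra_simps)
  next
    assume R: ?R
    obtain x where x: "d = gcd n d * x" using gcd_dvd2[of n d] by (rule dvdE)
    have i: "int (gcd n d) * int x = int d" by (simp only: of_nat_mult[symmetric] x[symmetric])
    show ?L using iter[OF R, of _ x] unfolding i by blast
  qed
qed

lemma card_rotation_invariant:
  assumes \<zeta>: "root_of_unity_of_order n \<zeta>" and q: "q = \<zeta> ^ d"
  shows "q ^ k * of_nat (card {f \<in> A_multidissections n k.
      \<forall>a b. f (edge n (a + int d) (b + int d)) = f (edge n a b)}) =
    schur [k, k] n (\<lambda>i. q ^ (i - 1))"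
proof -
  have n: "n > 0" using \<zeta> by (simp add: root_of_unity_of_order_def)
  define N where "N = gcd n d"
  obtain m where n_eq: "n = m * N" unfolding N_def by (metis dvdE gcd_dvd1 mult.commute)
  have N: "N > 0" using n by (simp add: N_def)
  have q_order: "root_of_unity_of_order m q"
    unfolding q by (rule root_of_unity_power[OF \<zeta> n_eq N_def])
  have fixed: "{f \<in> A_multidissections n k. \<forall>a b. f (edge n (a + int d) (b + int d)) = f (edge n a b)} =
    {f \<in> A_multidissections n k. \<forall>a b. f (edge n (a + int N) (b + int N)) = f (edge n a b)}"
    unfolding N_def by (intro Collect_cong conj_cong refl invariant_gcd_iff[OF n])
  show ?thesis
  proof (cases "m = 1")
    case True
    \<comment> \<open>Now \<open>N = n\<close> is a full turn and fixes every dissection, while at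
      \<open>q = 1\<close> the Schur polynomial counts tableaux.\<close>
    have "edge n (a + int N) (b + int N) = edge n a b" for a b
      by (rule edge_cong) (simp_all add: n_eq True)
    then have "card {f \<in> A_multidissections n k. \<forall>a b. f (edge n (a + int N) (b + int N)) = f (edge n a b)}
      = card (semistandard_tableaux [k, k] n)"
      using bij_betw_same_card[OF bij_betw_tableaux_ballot_pairs]
      by (simp add: card_A_multidissections)
    moreover have "q = 1" using q_order True by (simp add: root_of_unity_of_order_def)
    ultimately show ?thesis unfolding fixed schur_powers by simp
  next
    case False
    then have m2: "m \<ge> 2" using q_order by (simp add: root_of_unity_of_order_def)
    interpret rotation_period m N n using m2 N n_eq by unfold_locales
    have "n = m * card residues" by (simp add: n_eq)
    from schur_root_of_unity[OF q_order m2 _ this, of k] show ?thesis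
      unfolding fixed invariant_dissections_def[symmetric] card_invariant_dissections by simp
  qed
qed

lemma power_tableau_degree:
  assumes "T \<in> semistandard_tableaux [k, k] n"
  shows "z ^ k * z ^ (tableau_degree n k T - k) = (z :: 'a::comm_semiring_1) ^ tableau_degree n k T"
  using tableau_degree_ge[OF assms] by (simp flip: power_add)

theorem theorem2p5:
  fixes n k :: nat
  assumes "n \<ge> 3"
  shows "\<exists>P :: nat poly.
           [:0, 1:] ^ k * P = schur [k, k] n (\<lambda>i. [:0, 1:] ^ (i - 1)) \<and>
           exhibits_CSP (A_multidissections n k) (integer_mod_group n) 1 (rotation_action n k) P"
proof (intro exI conjI)
  let ?S = "semistandard_tableaux [k, k] n"
  \<comment> \<open>The factor \<open>q ^ k\<close> is removed from each monomial separately;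
    \<open>tableau_degree_ge\<close> makes the truncated difference exact.\<close>
  let ?P = "\<Sum>T\<in>?S. monom (1::nat) (tableau_degree n k T - k)"
  have "monom (1::nat) j = [:0, 1:] ^ j" for j
    unfolding monom_altdef by (rule smult_1_left)
  then show "[:0, 1:] ^ k * ?P = schur [k, k] n (\<lambda>i. [:0, 1:] ^ (i - 1))"
    unfolding schur_powers sum_distrib_left
    by (intro sum.cong refl) (simp only: power_tableau_degree)
  show "exhibits_CSP (A_multidissections n k) (integer_mod_group n) 1 (rotation_action n k) ?P"
    unfolding exhibits_CSP_def
  proof (intro conjI allI impI)
    show "group_action (integer_mod_group n) (A_multidissections n k) (rotation_action n k)"
      using assms by (intro group_action_rotation) simp
    show "generate (integer_mod_group n) {1} = carrier (integer_mod_group n)"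
      using assms by (intro generate_integer_mod_group) simp
    fix \<zeta> and d :: nat
    assume "root_of_unity_of_order (group.ord (integer_mod_group n) 1) \<zeta>"
    then have \<zeta>: "root_of_unity_of_order n \<zeta>" using assms by (simp add: ord_integer_mod_group)
    define q where "q = \<zeta> ^ d"
    \<comment> \<open>Nonvanishing permits cancelling \<open>q ^ k\<close> below.\<close>
    have "\<zeta> \<noteq> 0" using \<zeta> by (auto simp: root_of_unity_of_order_def power_0_left)
    then have "q \<noteq> 0" by (simp add: q_def)
    have "q ^ k * poly (map_poly of_nat ?P) q = schur [k, k] n (\<lambda>i. q ^ (i - 1))"
      unfolding poly_map_poly_sum_monom schur_powers sum_distrib_left
      by (intro sum.cong refl power_tableau_degree)
    also have "\<dots> = q ^ k * of_nat (card {f \<in> A_multidissections n k.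
      \<forall>a b. f (edge n (a + int d) (b + int d)) = f (edge n a b)})"
      by (rule card_rotation_invariant[OF \<zeta> q_def, symmetric])
    finally have eq: "poly (map_poly of_nat ?P) q = of_nat (card {f \<in> A_multidissections n k.
      \<forall>a b. f (edge n (a + int d) (b + int d)) = f (edge n a b)})"
      using \<open>q \<noteq> 0\<close> by simp
    have n2: "n \<ge> 2" using assms by simp
    show "of_nat (card (invariants (A_multidissections n k) (rotation_action n k)
        (1 [^]\<^bsub>integer_mod_group n\<^esub> d))) = poly (map_poly of_nat ?P) (\<zeta> ^ d)"
      unfolding invariants_rotation[OF n2] by (rule eq[unfolded q_def, symmetric])
  qed (use assms finite_A_multidissections in \<open>auto simp: carrier_integer_mod_group\<close>)
qed

end
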